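(* Let $1\le p<\infty$, let $a>0$, and let $w$ be a measurable scalar-valued function on $(0,\infty)$ such that (1) $w$ is unbounded, (2) $\lim_{t\to\infty}w(t)=\infty$, (3) there is a constant $b$ with $|w(t)|>b>1$ for all $t$. In the (real or complex) space $L_p(0,\infty)$ consider the unbounded time varying weighted backward shift operator $$(Tx)(t):=w(t)\,x(t+a),\qquad\text{so that}\qquad (T^nx)(t)=\prod_{i=0}^{n-1}w(t+ia)\;x(t+na),\quad n\ge 1,$$ with domain $$D(T):=\Big\{x\in L_p(0,\infty) : \int_0^\infty |w(t)x(t+a)|^p\,dt<+\infty\Big\}.$$ Then $T$ is chaotic. Moreover, if the space $L_p(0,\infty)$ is complex, then $$\sigma(T)=\sigma_p(T)=\mathbb{C}.$$
   Context: The scalar field is $\mathbb{R}$ or $\mathbb{C}$ according to whether the space is real or complex, and $w$ takes values in the scalar field. The condition $\lim_{t\to\infty}w(t)=\infty$ is understood as $|w(t)|\to\infty$ as $t\to\infty$. For a linear operator $T$ in a Banach space $X$ with domain $D(T)$, $D(T^{n})$ is the natural domain of the $n$-fold composition (with $D(T^0)=X$), and $D(T^\infty):=\bigcap_{n=0}^\infty D(T^n)$. A (possibly unbounded) operator $T$ is hypercyclic if there is a nonzero vector $x\in D(T^\infty)$ whose orbit $\{T^nx : n\ge 0\}$ is dense in $X$. A periodic point of $T$ is a vector $x\in D(T^\infty)$ such that $T^nx=x$ for some integer $n\ge 1$. $T$ is chaotic if it is hypercyclic and its set of periodic points is dense in $X$. For a closed linear operator $T$ in a complex Banach space $X$, the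 spectrum $\sigma(T)$ is the set of $\lambda\in\mathbb{C}$ for which $T-\lambda I:D(T)\to X$ is not bijective, and the point spectrum is $\sigma_p(T)=\{\lambda\in\mathbb{C} : T-\lambda I\text{ is not injective}\}$. *)

theory Defs
  imports "HOL-Analysis.Analysis"
begin

section \<open>Unbounded operators\<close>

text \<open>A normed space is given by a carrier \<open>X\<close> inside an abelian group \<open>'v\<close>, a norm \<open>N\<close> on \<open>X\<close>,
  and, for the spectrum, a scalar multiplication \<open>sc\<close>. An operator in \<open>X\<close> is given by its domain
  \<open>D \<subseteq> X\<close> and a map \<open>T\<close> on \<open>'v\<close> that sends \<open>D\<close> into \<open>X\<close>; the values of \<open>T\<close> outside
  \<open>D\<close> are irrelevant.\<close>

primrec dom_pow :: "'v set \<Rightarrow> 'v set \<Rightarrow> ('v \<Rightarrow> 'v) \<Rightarrow> nat \<Rightarrow> 'v set" where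
  "dom_pow X D T 0 = X"
| "dom_pow X D T (Suc n) = {x \<in> D. T x \<in> dom_pow X D T n}"

definition dom_inf :: "'v set \<Rightarrow> 'v set \<Rightarrow> ('v \<Rightarrow> 'v) \<Rightarrow> 'v set" where
  "dom_inf X D T = (\<Inter>n. dom_pow X D T n)"

definition norm_dense :: "'v::ab_group_add set \<Rightarrow> ('v \<Rightarrow> real) \<Rightarrow> 'v set \<Rightarrow> bool" where
  "norm_dense X N S \<longleftrightarrow> S \<subseteq> X \<and> (\<forall>y\<in>X. \<forall>e>0. \<exists>z\<in>S. N (z - y) < e)"

definition hypercyclic ::
    "'v::ab_group_add set \<Rightarrow> ('v \<Rightarrow> real) \<Rightarrow> 'v set \<Rightarrow> ('v \<Rightarrow> 'v) \<Rightarrow> bool" where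
  "hypercyclic X N D T \<longleftrightarrow>
     (\<exists>x\<in>dom_inf X D T. x \<noteq> 0 \<and> norm_dense X N {(T ^^ n) x |n. True})"

definition periodic_points :: "'v set \<Rightarrow> 'v set \<Rightarrow> ('v \<Rightarrow> 'v) \<Rightarrow> 'v set" where
  "periodic_points X D T = {x \<in> dom_inf X D T. \<exists>n\<ge>1. (T ^^ n) x = x}"

definition chaotic ::
    "'v::ab_group_add set \<Rightarrow> ('v \<Rightarrow> real) \<Rightarrow> 'v set \<Rightarrow> ('v \<Rightarrow> 'v) \<Rightarrow> bool" where
  "chaotic X N D T \<longleftrightarrow> hypercyclic X N D T \<and> norm_dense X N (periodic_points X D T)"

definition op_spectrum ::
    "(complex \<Rightarrow> 'v::ab_group_add \<Rightarrow> 'v) \<Rightarrow> 'v set \<Rightarrow> 'v set \<Rightarrow> ('v \<Rightarrow> 'v) \<Rightarrow> complex set" where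
  "op_spectrum sc X D T = {l. \<not> bij_betw (\<lambda>x. T x - sc l x) D X}"

definition op_point_spectrum ::
    "(complex \<Rightarrow> 'v::ab_group_add \<Rightarrow> 'v) \<Rightarrow> 'v set \<Rightarrow> ('v \<Rightarrow> 'v) \<Rightarrow> complex set" where
  "op_point_spectrum sc D T = {l. \<not> inj_on (\<lambda>x. T x - sc l x) D}"


section \<open>Measurable functions on the half-line modulo null sets\<close>

abbreviation half_line :: "real measure" where
  "half_line \<equiv> lebesgue_on {0<..}"

definition ae_eq :: "(real \<Rightarrow> 'k::{real_normed_field,second_countable_topology}) \<Rightarrow> (real \<Rightarrow> 'k) \<Rightarrow> bool"
  where "ae_eq f g \<longleftrightarrow> f \<in> borel_measurable half_line \<and> g \<in> borel_measurable half_line \<and>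
                       (AE t in half_line. f t = g t)"

quotient_type (overloaded) 'k L0 =
  "real \<Rightarrow> 'k::{real_normed_field,second_countable_topology}" / partial: ae_eq
proof (rule part_equivpI)
  show "\<exists>f::real \<Rightarrow> 'k. ae_eq f f"
    by (rule exI[of _ "\<lambda>_. 0"]) (simp add: ae_eq_def)
  show "symp (ae_eq :: (real \<Rightarrow> 'k) \<Rightarrow> _)"
    by (rule sympI) (auto simp: ae_eq_def elim: eventually_mono)
  show "transp (ae_eq :: (real \<Rightarrow> 'k) \<Rightarrow> _)"
    by (rule transpI) (auto simp: ae_eq_def elim: eventually_elim2)
qed

instantiation L0 :: ("{real_normed_field,second_countable_topology}") ab_group_add
begin

lift_definition zero_L0 :: "'a L0" is "\<lambda>_. 0"
  by (simp add: ae_eq_def)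

lift_definition plus_L0 :: "'a L0 \<Rightarrow> 'a L0 \<Rightarrow> 'a L0" is "\<lambda>f g t. f t + g t"
  by (auto simp: ae_eq_def elim: eventually_elim2)

lift_definition minus_L0 :: "'a L0 \<Rightarrow> 'a L0 \<Rightarrow> 'a L0" is "\<lambda>f g t. f t - g t"
  by (auto simp: ae_eq_def elim: eventually_elim2)

lift_definition uminus_L0 :: "'a L0 \<Rightarrow> 'a L0" is "\<lambda>f t. - f t"
  by (auto simp: ae_eq_def elim: eventually_mono)

instance
  by standard (transfer, simp add: ae_eq_def algebra_simps)+

end

lift_definition scale_L0 ::
    "'k::{real_normed_field,second_countable_topology} \<Rightarrow> 'k L0 \<Rightarrow> 'k L0"
  is "\<lambda>c f t. c * f t"
  by (auto simp: ae_eq_def elim: eventually_mono)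


section \<open>The spaces $L_p(0,\infty)$\<close>

lift_definition Lp_mass ::
    "real \<Rightarrow> 'k::{real_normed_field,second_countable_topology} L0 \<Rightarrow> ennreal"
  is "\<lambda>p f. \<integral>\<^sup>+ t. ennreal (norm (f t) powr p) \<partial>half_line"
  by (rule nn_integral_cong_AE) (auto simp: ae_eq_def elim: eventually_mono)

definition Lp :: "real \<Rightarrow> 'k::{real_normed_field,second_countable_topology} L0 set" where
  "Lp p = {x. Lp_mass p x < \<infinity>}"

definition Lp_norm :: "real \<Rightarrow> 'k::{real_normed_field,second_countable_topology} L0 \<Rightarrow> real" where
  "Lp_norm p x = enn2real (Lp_mass p x) powr (1 / p)"


section \<open>The weighted backward shift\<close>

text \<open>The definition goes through an arbitrary representative of \<open>x\<close>. By \<open>wshift_abs\<close> below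
  the result does not depend on it when \<open>w\<close> is measurable and \<open>a \<ge> 0\<close>; for other parameters
  \<open>wshift\<close> carries no meaning.\<close>

definition wshift :: "(real \<Rightarrow> 'k::{real_normed_field,second_countable_topology}) \<Rightarrow> real \<Rightarrow> 'k L0 \<Rightarrow> 'k L0"
  where "wshift w a x = abs_L0 (\<lambda>t. w t * rep_L0 x (t + a))"

definition wshift_dom ::
    "real \<Rightarrow> (real \<Rightarrow> 'k::{real_normed_field,second_countable_topology}) \<Rightarrow> real \<Rightarrow> 'k L0 set"
  where "wshift_dom p w a = {x \<in> Lp p. Lp_mass p (wshift w a x) < \<infinity>}"

lemma translate_measurable:
  assumes "a \<ge> 0"
  shows "(\<lambda>t. t + a) \<in> half_line \<rightarrow>\<^sub>M half_line"
proof (rule measurable_restrict_space3)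
  show "(\<lambda>t. t + a) \<in> lebesgue \<rightarrow>\<^sub>M lebesgue"
    using lebesgue_affine_measurable[of "\<lambda>_. 1" a] by (simp add: add.commute)
qed (use assms in auto)

lemma translate_AE:
  fixes P :: "real \<Rightarrow> bool"
  assumes "a \<ge> 0" and P: "AE t in half_line. P t"
  shows "AE t in half_line. P (t + a)"
proof -
  have "AE t in lebesgue. t \<in> {0<..} \<longrightarrow> P t"
    using P by (subst (asm) AE_restrict_space_iff) auto
  then obtain M where M: "M \<in> null_sets lebesgue" "{t. \<not> (t \<in> {0<..} \<longrightarrow> P t)} \<subseteq> M"
    by (auto simp: eventually_ae_filter)
  then have "(\<lambda>t. t - a) ` M \<in> null_sets lebesgue"
    using negligible_translation[of M "- a"]
    by (simp add: negligible_iff_null_sets add.commute)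
  moreover have "{t. \<not> (t \<in> {0<..} \<longrightarrow> P (t + a))} \<subseteq> (\<lambda>t. t - a) ` M"
  proof
    fix t assume "t \<in> {t. \<not> (t \<in> {0<..} \<longrightarrow> P (t + a))}"
    then have "t + a \<in> M" using M(2) assms(1) by auto
    then show "t \<in> (\<lambda>t. t - a) ` M" by (rule rev_image_eqI) simp
  qed
  ultimately have "AE t in lebesgue. t \<in> {0<..} \<longrightarrow> P (t + a)"
    by (auto simp: eventually_ae_filter)
  then show ?thesis
    by (subst AE_restrict_space_iff) auto
qed

lemma wshift_abs:
  assumes "a \<ge> 0" and w: "w \<in> borel_measurable half_line" and f: "f \<in> borel_measurable half_line"
  shows "wshift w a (abs_L0 f) = abs_L0 (\<lambda>t. w t * f (t + a))"
proof -
  have "ae_eq f f" using f by (simp add: ae_eq_def)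
  then have "ae_eq (rep_L0 (abs_L0 f)) f"
    using Quotient3_L0 by (rule rep_abs_rsp_left[rotated])
  then have r: "rep_L0 (abs_L0 f) \<in> borel_measurable half_line"
      "AE t in half_line. rep_L0 (abs_L0 f) t = f t"
    by (auto simp: ae_eq_def)
  have "AE t in half_line. w t * rep_L0 (abs_L0 f) (t + a) = w t * f (t + a)"
    using translate_AE[OF assms(1) r(2)] by eventually_elim simp
  then have "ae_eq (\<lambda>t. w t * rep_L0 (abs_L0 f) (t + a)) (\<lambda>t. w t * f (t + a))"
    using w measurable_compose[OF translate_measurable[OF assms(1)] r(1)]
      measurable_compose[OF translate_measurable[OF assms(1)] f]
    by (simp add: ae_eq_def)
  then show ?thesis
    unfolding wshift_def by (rule Quotient3_rel_abs[OF Quotient3_L0])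
qed

lemma wshift_pow_abs:
  assumes "a \<ge> 0" and w: "w \<in> borel_measurable half_line" and f: "f \<in> borel_measurable half_line"
  shows "(wshift w a ^^ n) (abs_L0 f) =
    abs_L0 (\<lambda>t. (\<Prod>i<n. w (t + real i * a)) * f (t + real n * a))"
proof (induction n)
  case 0
  show ?case by simp
next
  case (Suc n)
  have tr: "(\<lambda>t. g (t + real i * a)) \<in> borel_measurable half_line"
    if "g \<in> borel_measurable half_line" for g :: "real \<Rightarrow> 'a" and i
    using measurable_compose[OF translate_measurable that] assms(1) by simp
  have m: "(\<lambda>t. (\<Prod>i<n. w (t + real i * a)) * f (t + real n * a)) \<in> borel_measurable half_line"
    by (intro borel_measurable_times borel_measurable_prod tr w f)
  have e: "t + a + real i * a = t + real (Suc i) * a" for t i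
    by (simp add: algebra_simps)
  have "w t * ((\<Prod>i<n. w (t + a + real i * a)) * f (t + a + real n * a)) =
      (\<Prod>i<Suc n. w (t + real i * a)) * f (t + real (Suc n) * a)" for t
    unfolding e prod.lessThan_Suc_shift by (simp add: mult.assoc)
  then show ?case
    using Suc wshift_abs[OF assms(1) w m] by simp
qed

end

theory Submission
  imports Defs
begin

text \<open>The shift has the right inverse \<open>(S y)(t) = y(t - a) / w(t - a)\<close> for \<open>t > a\<close> (and \<open>0\<close>
  otherwise), which contracts by the factor \<open>1 / b\<close>. Functions \<open>y\<close> supported on a bounded set on which
  all the shifted weights are bounded are dense and are eventually annihilated by \<open>T\<close>. For such
  \<open>y\<close> the function \<open>\<Sum>\<^sub>j S\<^sup>j\<^sup>N y\<close> is \<open>N\<close>-periodic and close to \<open>y\<close> when \<open>N\<close> is large;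
  for a dense sequence \<open>y\<^sub>j\<close> and a rapidly increasing sequence \<open>n\<^sub>j\<close> the function
  \<open>\<Sum>\<^sub>j S^(n\<^sub>j) y\<^sub>j\<close> is a hypercyclic vector; and with \<open>y\<close> the indicator of \<open>(0, a]\<close>
  the function \<open>\<Sum>\<^sub>j \<lambda>\<^sup>j S\<^sup>j y\<close> is an eigenvector for \<open>\<lambda>\<close>, where convergence uses
  \<open>\<bar>w\<bar> \<rightarrow> \<infinity>\<close>. At every point these sums have only finitely many nonzero terms, so neither
  completeness of \<open>L\<^sub>p\<close> nor closedness of \<open>T\<close> is needed.\<close>

section \<open>The $p$-th power of the $L_p$ norm\<close>

text \<open>The root is left out and infinite values are allowed, so that integral inequalities
  apply directly. Over \<open>half_line\<close> this is \<open>Lp_mass\<close> on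
  representatives.\<close>

definition pmass :: "'a measure \<Rightarrow> real \<Rightarrow> ('a \<Rightarrow> 'k::{real_normed_field,second_countable_topology}) \<Rightarrow> ennreal"
  where "pmass M p f = (\<integral>\<^sup>+t. ennreal (norm (f t) powr p) \<partial>M)"

lemma pmass_cong:
  assumes "\<And>t. t \<in> space M \<Longrightarrow> norm (f t) = norm (g t)"
  shows "pmass M p f = pmass M p g"
  unfolding pmass_def by (intro nn_integral_cong) (simp add: assms)

lemma pmass_cong_AE:
  assumes "AE t in M. f t = g t"
  shows "pmass M p f = pmass M p g"
  unfolding pmass_def by (intro nn_integral_cong_AE) (use assms in eventually_elim, simp)

lemma pmass_mono:
  assumes "0 \<le> p" "\<And>t. t \<in> space M \<Longrightarrow> norm (f t) \<le> norm (g t)"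
  shows "pmass M p f \<le> pmass M p g"
  unfolding pmass_def by (intro nn_integral_mono ennreal_leI powr_mono2) (use assms in auto)

lemma pmass_zero [simp]: "pmass M p (\<lambda>t. 0) = 0"
  by (simp add: pmass_def)

lemma pmass_cmult:
  assumes [measurable]: "f \<in> borel_measurable M"
  shows "pmass M p (\<lambda>t. c * f t) = ennreal (norm c powr p) * pmass M p f"
  unfolding pmass_def
  by (subst nn_integral_cmult[symmetric]) (auto simp: norm_mult powr_mult ennreal_mult)

lemma pmass_le_cmult:
  assumes [measurable]: "f \<in> borel_measurable M" and "0 \<le> p" "0 \<le> K"
    and "\<And>t. t \<in> space M \<Longrightarrow> norm (g t) \<le> K * norm (f t)"
  shows "pmass M p g \<le> ennreal (K powr p) * pmass M p f"
  unfolding pmass_def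
proof (subst nn_integral_cmult[symmetric])
  show "(\<integral>\<^sup>+ t. ennreal (norm (g t) powr p) \<partial>M) \<le>
      (\<integral>\<^sup>+ t. ennreal (K powr p) * ennreal (norm (f t) powr p) \<partial>M)"
  proof (rule nn_integral_mono)
    fix t assume "t \<in> space M"
    then have "norm (g t) powr p \<le> (K * norm (f t)) powr p"
      using assms by (intro powr_mono2) auto
    then show "ennreal (norm (g t) powr p) \<le> ennreal (K powr p) * ennreal (norm (f t) powr p)"
      using assms by (simp add: powr_mult flip: ennreal_mult)
  qed
qed measurable

lemma pmass_minus_commute: "pmass M p (\<lambda>t. f t - g t) = pmass M p (\<lambda>t. g t - f t)"
  by (rule pmass_cong) (rule norm_minus_commute)

text \<open>The norm of a sum is at most twice the larger norm, which gives the factor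
  \<open>2 powr p\<close>. This weak triangle inequality serves all questions of finiteness and
  closure below.\<close>

lemma pmass_add:
  assumes [measurable]: "f \<in> borel_measurable M" "g \<in> borel_measurable M" and "0 \<le> p"
  shows "pmass M p (\<lambda>t. f t + g t) \<le> ennreal (2 powr p) * (pmass M p f + pmass M p g)"
proof -
  have "norm (f t + g t) powr p \<le> 2 powr p * (norm (f t) powr p + norm (g t) powr p)" for t
  proof -
    have "norm (f t + g t) powr p \<le> (2 * max (norm (f t)) (norm (g t))) powr p"
      using norm_triangle_ineq[of "f t" "g t"] \<open>0 \<le> p\<close> by (intro powr_mono2) auto
    also have "\<dots> = 2 powr p * max (norm (f t)) (norm (g t)) powr p"
      by (simp add: powr_mult)
    also have "\<dots> \<le> 2 powr p * (norm (f t) powr p + norm (g t) powr p)"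
      by (intro mult_left_mono) (auto simp: max_def)
    finally show ?thesis .
  qed
  then have "pmass M p (\<lambda>t. f t + g t) \<le>
      (\<integral>\<^sup>+t. ennreal (2 powr p) * (ennreal (norm (f t) powr p) + ennreal (norm (g t) powr p)) \<partial>M)"
    unfolding pmass_def by (intro nn_integral_mono) (simp flip: ennreal_plus ennreal_mult)
  also have "\<dots> = ennreal (2 powr p) * (pmass M p f + pmass M p g)"
    unfolding pmass_def by (subst nn_integral_cmult) (auto simp: nn_integral_add)
  finally show ?thesis .
qed

lemma pmass_diff:
  assumes [measurable]: "f \<in> borel_measurable M" "g \<in> borel_measurable M" and "0 \<le> p"
  shows "pmass M p (\<lambda>t. f t - g t) \<le> ennreal (2 powr p) * (pmass M p f + pmass M p g)"
proof -
  have "pmass M p (\<lambda>t. - g t) = pmass M p g"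
    by (rule pmass_cong) simp
  then show ?thesis
    using pmass_add[of f M "\<lambda>t. - g t" p] assms by simp
qed

lemma pmass_add_finite:
  assumes "f \<in> borel_measurable M" "g \<in> borel_measurable M" "0 \<le> p"
    and "pmass M p f < top" "pmass M p g < top"
  shows "pmass M p (\<lambda>t. f t + g t) < top"
proof -
  have "ennreal (2 powr p) * (pmass M p f + pmass M p g) < top"
    using assms(4,5) by (simp add: ennreal_mult_less_top)
  then show ?thesis
    using pmass_add[OF assms(1-3)] by (rule le_less_trans[rotated])
qed

lemma pmass_sum_finite:
  assumes "\<And>i. i \<in> I \<Longrightarrow> f i \<in> borel_measurable M" "0 \<le> p" "\<And>i. i \<in> I \<Longrightarrow> pmass M p (f i) < top"
  shows "pmass M p (\<lambda>t. \<Sum>i\<in>I. f i t) < top"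
  using assms(1,3)
proof (induction I rule: infinite_finite_induct)
  case (insert i I)
  then show ?case
    using pmass_add_finite[of "f i" M "\<lambda>t. \<Sum>i\<in>I. f i t" p] assms(2) by simp
qed auto

text \<open>The weights \<open>2 ^ Suc j\<close> replace Minkowski's inequality: their inverses sum to one, so
  the norm of a sum is at most the largest of the weighted norms.\<close>

lemma norm_sum_powr_le:
  fixes u :: "nat \<Rightarrow> 'b::real_normed_vector"
  assumes "0 \<le> p"
  shows "norm (\<Sum>j<n. u j) powr p \<le> (\<Sum>j<n. (2 ^ Suc j * norm (u j)) powr p)"
proof (cases "n = 0")
  case False
  define m where "m = Max ((\<lambda>j. 2 ^ Suc j * norm (u j)) ` {..<n})"
  have "m \<in> (\<lambda>j. 2 ^ Suc j * norm (u j)) ` {..<n}"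
    unfolding m_def using False by (intro Max_in) auto
  then obtain i where i: "i < n" "m = 2 ^ Suc i * norm (u i)" by auto
  have m: "2 ^ Suc j * norm (u j) \<le> m" if "j < n" for j
    unfolding m_def using that by (intro Max_ge) auto
  have "norm (u j) \<le> m * (1/2) ^ Suc j" if "j < n" for j
    using m[OF that] by (simp add: field_simps)
  then have "(\<Sum>j<n. norm (u j)) \<le> (\<Sum>j<n. m * (1/2) ^ Suc j)"
    by (intro sum_mono) auto
  also have "\<dots> = m * (1 - (1/2) ^ n)"
  proof -
    have "(\<Sum>j<n. (1/2::real) ^ Suc j) = 1 - (1/2) ^ n"
      by (induction n) (auto simp: field_simps)
    then show ?thesis by (simp only: sum_distrib_left[symmetric])
  qed
  also have "\<dots> \<le> m"
    using i(2) by (intro mult_left_le) auto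
  finally have "norm (\<Sum>j<n. u j) \<le> 2 ^ Suc i * norm (u i)"
    using norm_sum[of u "{..<n}"] i(2) by simp
  then have "norm (\<Sum>j<n. u j) powr p \<le> (2 ^ Suc i * norm (u i)) powr p"
    using assms by (intro powr_mono2) auto
  also have "\<dots> \<le> (\<Sum>j<n. (2 ^ Suc j * norm (u j)) powr p)"
    using i(1) by (intro member_le_sum) auto
  finally show ?thesis .
qed simp

text \<open>The weighted estimate for finite sums holds at every point, with the number of terms
  depending on the point; monotone convergence then exchanges sum and integral.\<close>

lemma pmass_series:
  assumes [measurable]: "\<And>j. F j \<in> borel_measurable M" and "0 \<le> p"
    and f: "\<And>t. t \<in> space M \<Longrightarrow> \<exists>n. f t = (\<Sum>j<n. F j t)"
  shows "pmass M p f \<le> (\<Sum>j. ennreal ((2 ^ Suc j) powr p) * pmass M p (F j))"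
proof -
  have "pmass M p f \<le> (\<integral>\<^sup>+t. (\<Sum>j. ennreal ((2 ^ Suc j) powr p) * ennreal (norm (F j t) powr p)) \<partial>M)"
    unfolding pmass_def
  proof (rule nn_integral_mono)
    fix t assume "t \<in> space M"
    from f[OF this] obtain n where n: "f t = (\<Sum>j<n. F j t)" by blast
    have "ennreal (norm (f t) powr p) \<le> ennreal (\<Sum>j<n. (2 ^ Suc j * norm (F j t)) powr p)"
      unfolding n using \<open>0 \<le> p\<close> by (intro ennreal_leI norm_sum_powr_le)
    also have "\<dots> = (\<Sum>j<n. ennreal ((2 ^ Suc j) powr p) * ennreal (norm (F j t) powr p))"
      by (subst sum_ennreal[symmetric]) (auto simp: powr_mult ennreal_mult)
    also have "\<dots> \<le> (\<Sum>j. ennreal ((2 ^ Suc j) powr p) * ennreal (norm (F j t) powr p))"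
      by (rule sum_le_suminf) auto
    finally show "ennreal (norm (f t) powr p) \<le>
      (\<Sum>j. ennreal ((2 ^ Suc j) powr p) * ennreal (norm (F j t) powr p))" .
  qed
  also have "\<dots> = (\<Sum>j. ennreal ((2 ^ Suc j) powr p) * pmass M p (F j))"
    by (subst nn_integral_suminf) (auto simp: pmass_def nn_integral_cmult)
  finally show ?thesis .
qed

text \<open>Dominated convergence for the \<open>p\<close>-th powers of the errors, with
  \<open>norm (g t) powr p\<close> as integrable majorant.\<close>

lemma pmass_dominated_convergence:
  assumes [measurable]: "\<And>i. s i \<in> borel_measurable M" "f \<in> borel_measurable M" "g \<in> borel_measurable M"
    and p: "0 < p" and fin: "pmass M p g < top"
    and lim: "\<And>t. t \<in> space M \<Longrightarrow> (\<lambda>i. s i t) \<longlonglongrightarrow> f t"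
    and bound: "\<And>i t. t \<in> space M \<Longrightarrow> norm (s i t - f t) \<le> norm (g t)"
  shows "(\<lambda>i. pmass M p (\<lambda>t. s i t - f t)) \<longlonglongrightarrow> 0"
proof -
  have "(\<lambda>i. pmass M p (\<lambda>t. s i t - f t)) \<longlonglongrightarrow> (\<integral>\<^sup>+t. ennreal 0 \<partial>M)"
    unfolding pmass_def
  proof (rule nn_integral_dominated_convergence[where w = "\<lambda>t. ennreal (norm (g t) powr p)"])
    show "AE t in M. (\<lambda>i. ennreal (norm (s i t - f t) powr p)) \<longlonglongrightarrow> ennreal 0"
    proof (rule AE_I2)
      fix t assume "t \<in> space M"
      from lim[OF this] have "(\<lambda>i. norm (s i t - f t)) \<longlonglongrightarrow> 0"
        by (simp add: LIM_zero tendsto_norm_zero)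
      then have "(\<lambda>i. norm (s i t - f t) powr p) \<longlonglongrightarrow> 0"
        using p by (intro tendsto_zero_powrI[where b = p]) auto
      then show "(\<lambda>i. ennreal (norm (s i t - f t) powr p)) \<longlonglongrightarrow> ennreal 0"
        by (intro tendsto_ennrealI)
    qed
  qed (use fin p bound in \<open>auto simp: pmass_def intro!: ennreal_leI powr_mono2\<close>)
  then show ?thesis by simp
qed

section \<open>Closure with respect to the p-mass\<close>

definition pclosure :: "'a measure \<Rightarrow> real \<Rightarrow> ('a \<Rightarrow> 'k::{real_normed_field,second_countable_topology}) set
    \<Rightarrow> ('a \<Rightarrow> 'k) set"
  where "pclosure M p Q = {f \<in> borel_measurable M. \<forall>e>0. \<exists>q\<in>Q. pmass M p (\<lambda>t. f t - q t) < ennreal e}"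

text \<open>Made for \<open>K = 2 powr p\<close>: two errors below \<open>e / (4 * K)\<close> add up
  to at most \<open>e / (2 * K)\<close>, and the factor \<open>K\<close> leaves
  \<open>e / 2\<close>.\<close>

lemma half_sum_less:
  assumes "x < ennreal (e / (4 * K))" "y < ennreal (e / (4 * K))" "0 < K" "0 < e"
  shows "ennreal K * (x + y) < ennreal e"
proof -
  have "x + y \<le> ennreal (e / (4 * K)) + ennreal (e / (4 * K))"
    using assms by (intro add_mono) auto
  also have "\<dots> = ennreal (e / (2 * K))"
    using assms by (simp flip: ennreal_plus)
  finally have "ennreal K * (x + y) \<le> ennreal K * ennreal (e / (2 * K))"
    by (rule mult_left_mono) simp
  also have "\<dots> = ennreal (e / 2)"
    using assms by (simp flip: ennreal_mult)
  also have "\<dots> < ennreal e"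
    using assms by (intro ennreal_lessI) auto
  finally show ?thesis .
qed

lemma pclosure_limit:
  assumes Q: "Q \<subseteq> borel_measurable M" and p: "0 \<le> p"
    and s: "\<And>i. s i \<in> pclosure M p Q" and f: "f \<in> borel_measurable M"
    and lim: "(\<lambda>i. pmass M p (\<lambda>t. s i t - f t)) \<longlonglongrightarrow> 0"
  shows "f \<in> pclosure M p Q"
  unfolding pclosure_def
proof (intro CollectI conjI f allI impI)
  fix e :: real assume "0 < e"
  let ?K = "2 powr p"
  have d: "0 < e / (4 * ?K)"
    using \<open>0 < e\<close> by simp
  have "\<forall>\<^sub>F i in sequentially. pmass M p (\<lambda>t. s i t - f t) < ennreal (e / (4 * ?K))"
    using order_tendstoD(2)[OF lim] d by simp
  then obtain i where i: "pmass M p (\<lambda>t. s i t - f t) < ennreal (e / (4 * ?K))"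
    by (auto simp: eventually_sequentially)
  obtain q where q: "q \<in> Q" "pmass M p (\<lambda>t. s i t - q t) < ennreal (e / (4 * ?K))"
    using s[of i] d unfolding pclosure_def by blast
  have "s i \<in> borel_measurable M" using s[of i] by (simp add: pclosure_def)
  then have "pmass M p (\<lambda>t. (f t - s i t) + (s i t - q t))
      \<le> ennreal ?K * (pmass M p (\<lambda>t. f t - s i t) + pmass M p (\<lambda>t. s i t - q t))"
    using Q q(1) f p by (intro pmass_add) auto
  also have "\<dots> < ennreal e"
    using i q(2) \<open>0 < e\<close> by (intro half_sum_less) (auto simp: pmass_minus_commute[of M p f "s i"])
  finally show "\<exists>q\<in>Q. pmass M p (\<lambda>t. f t - q t) < ennreal e"
    using q(1) by auto
qed

lemma pclosure_add:
  assumes Q: "Q \<subseteq> borel_measurable M" and p: "0 \<le> p"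
    and add: "\<And>q r. q \<in> Q \<Longrightarrow> r \<in> Q \<Longrightarrow> (\<lambda>t. q t + r t) \<in> Q"
    and f: "f \<in> pclosure M p Q" and g: "g \<in> pclosure M p Q"
  shows "(\<lambda>t. f t + g t) \<in> pclosure M p Q"
  unfolding pclosure_def
proof (intro CollectI conjI allI impI)
  show "(\<lambda>t. f t + g t) \<in> borel_measurable M"
    using f g by (auto simp: pclosure_def)
  fix e :: real assume "0 < e"
  let ?K = "2 powr p"
  have d: "0 < e / (4 * ?K)"
    using \<open>0 < e\<close> by simp
  obtain q where q: "q \<in> Q" "pmass M p (\<lambda>t. f t - q t) < ennreal (e / (4 * ?K))"
    using f d unfolding pclosure_def by blast
  obtain r where r: "r \<in> Q" "pmass M p (\<lambda>t. g t - r t) < ennreal (e / (4 * ?K))"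
    using g d unfolding pclosure_def by blast
  have "pmass M p (\<lambda>t. (f t - q t) + (g t - r t))
      \<le> ennreal ?K * (pmass M p (\<lambda>t. f t - q t) + pmass M p (\<lambda>t. g t - r t))"
    using Q q(1) r(1) f g p by (intro pmass_add) (auto simp: pclosure_def)
  also have "\<dots> < ennreal e"
    using q(2) r(2) \<open>0 < e\<close> by (intro half_sum_less) auto
  finally have "pmass M p (\<lambda>t. f t + g t - (q t + r t)) < ennreal e"
    by (simp add: add_diff_add)
  then show "\<exists>q\<in>Q. pmass M p (\<lambda>t. f t + g t - q t) < ennreal e"
    by (rule bexI[where x = "\<lambda>t. q t + r t"]) (rule add[OF q(1) r(1)])
qed

lemma pclosure_sum:
  assumes Q: "Q \<subseteq> borel_measurable M" and p: "0 \<le> p"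
    and add: "\<And>q r. q \<in> Q \<Longrightarrow> r \<in> Q \<Longrightarrow> (\<lambda>t. q t + r t) \<in> Q" and zero: "(\<lambda>t. 0) \<in> Q"
    and f: "\<And>i. i \<in> I \<Longrightarrow> f i \<in> pclosure M p Q"
  shows "(\<lambda>t. \<Sum>i\<in>I. f i t) \<in> pclosure M p Q"
proof -
  have 0: "(\<lambda>t. 0) \<in> pclosure M p Q"
    unfolding pclosure_def using zero by force
  show ?thesis using f
  proof (induction I rule: infinite_finite_induct)
    case (insert i I)
    have "(\<lambda>t. f i t + (\<Sum>i\<in>I. f i t)) \<in> pclosure M p Q"
      by (rule pclosure_add[OF Q p]) (fact add, use insert in simp_all)
    then show ?case using insert by simp
  qed (use 0 in auto)
qed

section \<open>Separability of $L_p(0,\infty)$\<close>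

text \<open>The form in which the density arguments take limits: pointwise convergence with a
  majorant for the errors rather than for the functions.\<close>

lemma pclosure_dominated:
  assumes Q: "Q \<subseteq> borel_measurable M" and p: "0 < p"
    and s: "\<And>i. s i \<in> pclosure M p Q"
    and f: "f \<in> borel_measurable M" and g: "g \<in> borel_measurable M" "pmass M p g < top"
    and lim: "\<And>t. t \<in> space M \<Longrightarrow> (\<lambda>i. s i t) \<longlonglongrightarrow> f t"
    and bound: "\<And>i t. t \<in> space M \<Longrightarrow> norm (s i t - f t) \<le> norm (g t)"
  shows "f \<in> pclosure M p Q"
proof (rule pclosure_limit[OF Q _ s f])
  show "(\<lambda>i. pmass M p (\<lambda>t. s i t - f t)) \<longlonglongrightarrow> 0"
    using s by (intro pmass_dominated_convergence[OF _ f g(1) p g(2) lim bound])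
      (auto simp: pclosure_def)
qed (use p in simp)

lemma pclosure_cong_AE:
  assumes f: "f \<in> pclosure M p Q" and g: "g \<in> borel_measurable M" and eq: "AE t in M. f t = g t"
  shows "g \<in> pclosure M p Q"
proof -
  have "pmass M p (\<lambda>t. g t - q t) = pmass M p (\<lambda>t. f t - q t)" for q
    by (rule pmass_cong_AE) (use eq in eventually_elim, simp)
  then show ?thesis using f g by (simp add: pclosure_def)
qed

section \<open>Finite combinations of half-open intervals\<close>

lemma borel_measurable_half_lineI:
  "f \<in> borel_measurable borel \<Longrightarrow> f \<in> borel_measurable half_line"
  by (intro measurable_restrict_space1 measurable_completion) simp

lemma pmass_interval_finite:
  "pmass half_line p (\<lambda>t. if l < t \<and> t \<le> r then c else 0) < top"
proof -
  have "pmass half_line p (\<lambda>t. if l < t \<and> t \<le> r then c else 0) \<le>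
      (\<integral>\<^sup>+t. ennreal (norm c powr p) * indicator {l..r} t \<partial>lebesgue)"
    unfolding pmass_def
    by (subst nn_integral_restrict_space) (auto intro!: nn_integral_mono simp: indicator_def)
  also have "\<dots> < top"
    by (subst nn_integral_cmult_indicator) (auto simp: ennreal_mult_less_top emeasure_lborel_Icc_eq)
  finally show ?thesis .
qed

text \<open>Coded by lists of a value and two end points: lists over a countable set are countable,
  and appending lists adds the functions.\<close>

definition step_fun :: "('k::{real_normed_field,second_countable_topology} \<times> real \<times> real) list \<Rightarrow> real \<Rightarrow> 'k"
  where "step_fun xs t = (\<Sum>(c, l, r)\<leftarrow>xs. if l < t \<and> t \<le> r then c else 0)"

lemma step_fun_simps [simp]:
  "step_fun [] = (\<lambda>t. 0)"
  "step_fun ((c, l, r) # xs) = (\<lambda>t. (if l < t \<and> t \<le> r then c else 0) + step_fun xs t)"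
  "step_fun (xs @ ys) = (\<lambda>t. step_fun xs t + step_fun ys t)"
  by (auto simp: step_fun_def fun_eq_iff)

lemma step_fun_measurable: "step_fun xs \<in> borel_measurable half_line"
proof (induction xs)
  case (Cons x xs)
  obtain c l r where x: "x = (c, l, r)" by (cases x)
  have "(\<lambda>t. if l < t \<and> t \<le> r then c else 0) \<in> borel_measurable half_line"
    by (rule borel_measurable_half_lineI) measurable
  with Cons show ?case by (simp add: x)
qed simp

lemma pmass_step_fun_finite:
  assumes "0 \<le> p"
  shows "pmass half_line p (step_fun xs) < top"
proof (induction xs)
  case (Cons x xs)
  obtain c l r where x: "x = (c, l, r)" by (cases x)
  have "(\<lambda>t. if l < t \<and> t \<le> r then c else 0) \<in> borel_measurable half_line"
    by (rule borel_measurable_half_lineI) measurable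
  then show ?case
    unfolding x step_fun_simps
    by (intro pmass_add_finite step_fun_measurable pmass_interval_finite Cons assms)
qed simp

section \<open>Density of step functions with values in a dense set and rational end points\<close>

context
  fixes D :: "'k::{real_normed_field,second_countable_topology} set" and p :: real
  assumes D: "\<And>X. open X \<Longrightarrow> X \<noteq> {} \<Longrightarrow> \<exists>d\<in>D. d \<in> X" and p: "0 < p"
begin

private definition "steps = step_fun ` lists (D \<times> \<rat> \<times> \<rat>)"

private abbreviation "cl \<equiv> pclosure half_line p steps"

private lemma steps_measurable: "steps \<subseteq> borel_measurable half_line"
  by (auto simp: steps_def step_fun_measurable)

private lemma steps_add: "q \<in> steps \<Longrightarrow> r \<in> steps \<Longrightarrow> (\<lambda>t. q t + r t) \<in> steps"
  unfolding steps_def by (auto intro!: image_eqI simp flip: step_fun_simps(3))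

private lemma steps_zero: "(\<lambda>t. 0) \<in> steps"
  unfolding steps_def by (rule image_eqI[of _ _ "[]"]) auto

private lemma cl_sum: "(\<And>i. i \<in> I \<Longrightarrow> f i \<in> cl) \<Longrightarrow> (\<lambda>t. \<Sum>i\<in>I. f i t) \<in> cl"
  using p by (intro pclosure_sum steps_measurable steps_add steps_zero) auto

private lemma cl_add: "f \<in> cl \<Longrightarrow> g \<in> cl \<Longrightarrow> (\<lambda>t. f t + g t) \<in> cl"
  using p by (intro pclosure_add steps_measurable steps_add) auto

private lemmas cl_dominated = pclosure_dominated[OF steps_measurable p]

text \<open>End points are approximated by rationals strictly from above, which gives pointwise
  convergence even at \<open>l\<close> and \<open>r\<close>; the value \<open>c\<close> is
  approximated from \<open>D\<close>.\<close>

private lemma interval_in_cl: "(\<lambda>t. if l < t \<and> t \<le> r then c else 0) \<in> cl"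
proof -
  define \<epsilon> where "\<epsilon> i = inverse (real (Suc i))" for i
  have \<epsilon>: "0 < \<epsilon> i" "\<epsilon> i \<le> 1" for i by (auto simp: \<epsilon>_def field_simps)
  have \<epsilon>0: "\<epsilon> \<longlonglongrightarrow> 0" unfolding \<epsilon>_def by (rule LIMSEQ_inverse_real_of_nat)
  have "\<exists>d\<in>D. d \<in> ball c (\<epsilon> i)" for i
    using \<epsilon>(1)[of i] by (intro D) auto
  then obtain d where d: "\<And>i. d i \<in> D" "\<And>i. dist c (d i) < \<epsilon> i"
    unfolding mem_ball by metis
  have "\<exists>q\<in>\<rat>. x < q \<and> q < x + \<epsilon> i" for x i
    using Rats_dense_in_real[of x "x + \<epsilon> i"] \<epsilon>(1)[of i] by simp
  then obtain q where q: "\<And>x i. q x i \<in> \<rat>" "\<And>x i. x < q x i" "\<And>x i. q x i < x + \<epsilon> i"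
    by metis
  have qlim: "q x \<longlonglongrightarrow> x" for x
  proof (rule real_tendsto_sandwich[where f = "\<lambda>_. x" and h = "\<lambda>i. x + \<epsilon> i"])
    show "(\<lambda>i. x + \<epsilon> i) \<longlonglongrightarrow> x" using tendsto_add[OF tendsto_const \<epsilon>0, of x] by simp
    show "\<forall>\<^sub>F i in sequentially. x \<le> q x i" "\<forall>\<^sub>F i in sequentially. q x i \<le> x + \<epsilon> i"
      using q(2,3) by (auto simp: less_imp_le)
  qed auto
  have dlim: "d \<longlonglongrightarrow> c"
  proof (rule metric_LIMSEQ_I)
    fix e :: real assume "0 < e"
    then obtain N where N: "\<And>i. i \<ge> N \<Longrightarrow> \<epsilon> i < e"
      using order_tendstoD(2)[OF \<epsilon>0] by (auto simp: eventually_sequentially)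
    show "\<exists>N. \<forall>i\<ge>N. dist (d i) c < e"
      using d(2) N by (metis dist_commute less_trans)
  qed
  let ?s = "\<lambda>i t. if q l i < t \<and> t \<le> q r i then d i else 0"
  \<comment> \<open>A majorant of the error: \<open>norm (d i)\<close> is at most
    \<open>norm c + 1\<close>, and the approximating intervals lie in \<open>{l<..r + 1}\<close>
    because every \<open>\<epsilon> i\<close> is at most 1.\<close>
  let ?g = "\<lambda>t. if l < t \<and> t \<le> r + 1 then of_real (2 * norm c + 1) else 0 :: 'k"
  show ?thesis
  proof (rule cl_dominated[where s = ?s and g = ?g])
    fix i
    have "step_fun [(d i, q l i, q r i)] \<in> steps"
      unfolding steps_def using d(1) q(1) by (intro imageI) simp
    then have "?s i \<in> steps" by simp
    then show "?s i \<in> cl"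
      using steps_measurable by (force simp: pclosure_def)
  next
    fix t
    show "(\<lambda>i. ?s i t) \<longlonglongrightarrow> (if l < t \<and> t \<le> r then c else 0)"
    proof (cases "l < t \<and> t \<le> r")
      case True
      have "t \<le> q r i" for i
        using q(2)[of r i] True by simp
      moreover have "\<forall>\<^sub>F i in sequentially. q l i < t"
        using order_tendstoD(2)[OF qlim[of l], of t] True by simp
      ultimately have "\<forall>\<^sub>F i in sequentially. ?s i t = d i"
        by (auto elim!: eventually_mono)
      then show ?thesis
        unfolding if_P[OF True] using dlim by (simp only: tendsto_cong)
    next
      case False
      have "\<forall>\<^sub>F i in sequentially. ?s i t = 0"
      proof (cases "t \<le> l")
        case True
        have "\<not> q l i < t" for i
          using q(2)[of l i] True by simp
        then show ?thesis by simp
      next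
        case nl: False
        then have "r < t" using False by auto
        then show ?thesis
          using order_tendstoD(2)[OF qlim[of r], of t] by (auto elim!: eventually_mono)
      qed
      then show ?thesis
        unfolding if_not_P[OF False] by (rule tendsto_eventually)
    qed
  next
    fix i t
    have "norm (d i - c) \<le> 1"
      using d(2)[of i] \<epsilon>(2)[of i] by (simp add: dist_norm norm_minus_commute)
    then have "norm (d i - c) \<le> 2 * norm c + 1" "norm (d i) \<le> 2 * norm c + 1"
      using norm_ge_zero[of c] norm_triangle_ineq2[of "d i" c] by linarith+
    moreover have "l < q l i" "r < q r i" "q r i \<le> r + 1"
      using q(2,3)[of r i] q(2)[of l i] \<epsilon>(2)[of i] by auto
    moreover have "norm (of_real (2 * norm c + 1) :: 'k) = 2 * norm c + 1"
      by (simp only: norm_of_real) simp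
    ultimately show "norm (?s i t - (if l < t \<and> t \<le> r then c else 0)) \<le> norm (?g t)"
      by auto
  next
    show "pmass half_line p ?g < top" by (rule pmass_interval_finite)
  qed (auto intro!: borel_measurable_half_lineI)
qed

text \<open>Dynkin's argument: the half-open intervals are stable under intersection and generate
  the Borel sets, and the property passes to complements and countable disjoint unions. The cut at
  \<open>k\<close> keeps the mass finite; \<open>c\<close> varies because complements use
  \<open>- c\<close>.\<close>

private lemma borel_in_cl:
  assumes "E \<in> sets borel"
  shows "(\<lambda>t. if t \<in> E \<and> 0 < t \<and> t \<le> k then c else 0) \<in> cl"
proof -
  have "Int_stable (range (\<lambda>(a, b). {a <.. b::real}))"
    by (auto simp: Int_stable_def)
  moreover have "range (\<lambda>(a, b). {a <.. b::real}) \<subseteq> Pow UNIV"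
    by simp
  moreover have "E \<in> sigma_sets UNIV (range (\<lambda>(a, b). {a <.. b::real}))"
    using assms by (subst (asm) borel_sigma_sets_Ioc) (simp add: sets_measure_of)
  ultimately show ?thesis
  proof (induction E arbitrary: c rule: sigma_sets_induct_disjoint)
    case (basic E)
    then obtain l r where E: "E = {l<..r}" by auto
    have "(\<lambda>t. if t \<in> E \<and> 0 < t \<and> t \<le> k then c else 0) = (\<lambda>t. if max l 0 < t \<and> t \<le> min r k then c else 0)"
      by (auto simp: E)
    then show ?case by (simp only: interval_in_cl)
  next
    case empty
    then show ?case using cl_sum[of "{}"] by simp
  next
    case (compl E)
    have "(\<lambda>t. if t \<in> UNIV - E \<and> 0 < t \<and> t \<le> k then c else 0) =
        (\<lambda>t. (if 0 < t \<and> t \<le> k then c else 0) + (if t \<in> E \<and> 0 < t \<and> t \<le> k then - c else 0))"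
      by auto
    then show ?case using cl_add[OF interval_in_cl compl(2)] by simp
  next
    case (union A)
    let ?g = "\<lambda>t. if 0 < t \<and> t \<le> k then c else 0"
    let ?s = "\<lambda>n t. \<Sum>i<n. if t \<in> A i \<and> 0 < t \<and> t \<le> k then c else 0"
    \<comment> \<open>By disjointness at most one summand is nonzero at each point.\<close>
    have s: "?s n t = (if t \<in> (\<Union>i<n. A i) \<and> 0 < t \<and> t \<le> k then c else 0)" for n t
    proof (cases "t \<in> (\<Union>i<n. A i) \<and> 0 < t \<and> t \<le> k")
      case True
      then obtain i where i: "i < n" "t \<in> A i" by auto
      have "t \<in> A j \<longleftrightarrow> j = i" for j
        using union(1) i(2) by (auto simp: disjoint_family_on_def)
      then show ?thesis using True i by simp
    qed (auto intro!: sum.neutral)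
    have [measurable]: "A i \<in> sets borel" for i
      using union(2) by (subst borel_sigma_sets_Ioc) (auto simp: sets_measure_of)
    show ?case
    proof (rule cl_dominated[where s = ?s and g = ?g])
      show "?s n \<in> cl" for n by (intro cl_sum union)
      fix t
      show "(\<lambda>n. ?s n t) \<longlonglongrightarrow> (if t \<in> (\<Union>i. A i) \<and> 0 < t \<and> t \<le> k then c else 0)"
      proof (cases "t \<in> (\<Union>i. A i)")
        case True
        then obtain i where "t \<in> A i" by auto
        then have "\<forall>\<^sub>F n in sequentially. ?s n t = (if t \<in> (\<Union>i. A i) \<and> 0 < t \<and> t \<le> k then c else 0)"
          unfolding s by (intro eventually_sequentiallyI[of "Suc i"]) auto
        then show ?thesis by (rule tendsto_eventually)
      next
        case False
        then show ?thesis by (simp cong: if_cong)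
      qed
    next
      fix n t
      show "norm (?s n t - (if t \<in> (\<Union>i. A i) \<and> 0 < t \<and> t \<le> k then c else 0)) \<le> norm (?g t)"
        unfolding s by auto
    next
      show "(\<lambda>t. if t \<in> (\<Union>i. A i) \<and> 0 < t \<and> t \<le> k then c else 0) \<in> borel_measurable half_line"
        by (intro borel_measurable_half_lineI) measurable
    next
    show "pmass half_line p ?g < top" by (rule pmass_interval_finite)
  qed (auto intro!: borel_measurable_half_lineI)
  qed
qed

text \<open>A Lebesgue set differs from a Borel set only inside a null set, which
  \<open>pclosure_cong_AE\<close> ignores.\<close>

private lemma measurable_set_in_cl:
  assumes "E \<in> sets half_line"
  shows "(\<lambda>t. if t \<in> E \<and> 0 < t \<and> t \<le> k then c else 0) \<in> cl"
proof -
  have "E \<in> sets lebesgue"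
    using assms by (auto simp: sets_restrict_space)
  then obtain S N N' where E: "E = S \<union> N" "N \<subseteq> N'" "N' \<in> null_sets lborel" "S \<in> sets lborel"
    by (rule sets_completionE)
  have "AE t in lebesgue. t \<notin> N'"
    using E(3) by (intro AE_completion AE_not_in)
  then have "AE t in half_line. t \<notin> N'"
    by (subst AE_restrict_space_iff) (auto elim: eventually_mono)
  then have "AE t in half_line. (if t \<in> S \<and> 0 < t \<and> t \<le> k then c else 0) =
      (if t \<in> E \<and> 0 < t \<and> t \<le> k then c else 0)"
    by eventually_elim (use E in auto)
  moreover have "(\<lambda>t. if t \<in> S \<and> 0 < t \<and> t \<le> k then c else 0) \<in> cl"
    using E(4) by (intro borel_in_cl) simp
  moreover have "(\<lambda>t. if t \<in> E \<and> 0 < t \<and> t \<le> k then c else 0) \<in> borel_measurable half_line"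
  proof -
    have [measurable]: "(\<lambda>t. if 0 < t \<and> t \<le> k then c else 0) \<in> borel_measurable half_line"
      by (rule borel_measurable_half_lineI) measurable
    have "(\<lambda>t. if t \<in> E then if 0 < t \<and> t \<le> k then c else 0 else 0) \<in> borel_measurable half_line"
      using assms by measurable
    also have "(\<lambda>t. if t \<in> E then if 0 < t \<and> t \<le> k then c else 0 else 0) =
        (\<lambda>t. if t \<in> E \<and> 0 < t \<and> t \<le> k then c else 0)" by auto
    finally show ?thesis .
  qed
  ultimately show ?thesis by (rule pclosure_cong_AE[rotated 2])
qed

text \<open>Decomposition over the finitely many values. As \<open>s\<close> vanishes beyond
  \<open>k\<close>, cutting the level sets at \<open>k\<close> loses nothing.\<close>

private lemma simple_in_cl:
  assumes s: "simple_function half_line s" and 0: "\<And>t. 0 < t \<Longrightarrow> k < t \<Longrightarrow> s t = 0"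
  shows "s \<in> cl"
proof (rule pclosure_cong_AE)
  let ?E = "\<lambda>c. s -` {c} \<inter> space half_line"
  show "(\<lambda>t. \<Sum>c\<in>s ` {0<..}. if t \<in> ?E c \<and> 0 < t \<and> t \<le> k then c else 0) \<in> cl"
    using s by (intro cl_sum measurable_set_in_cl simple_functionD)
  show "s \<in> borel_measurable half_line"
    using s by (rule borel_measurable_simple_function)
  have fin: "finite (s ` {0<..})"
    using simple_functionD(1)[OF s] by simp
  show "AE t in half_line. (\<Sum>c\<in>s ` {0<..}. if t \<in> ?E c \<and> 0 < t \<and> t \<le> k then c else 0) = s t"
  proof (rule AE_I2)
    fix t assume "t \<in> space half_line"
    then have t: "0 < t" by simp
    have "(\<Sum>c\<in>s ` {0<..}. if t \<in> ?E c \<and> 0 < t \<and> t \<le> k then c else 0) =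
        (\<Sum>c\<in>s ` {0<..}. if c = s t then if t \<le> k then c else 0 else 0)"
      using t by (intro sum.cong) auto
    also have "\<dots> = s t"
      using t fin 0[OF t] by (simp add: sum.delta')
    finally show "(\<Sum>c\<in>s ` {0<..}. if t \<in> ?E c \<and> 0 < t \<and> t \<le> k then c else 0) = s t" .
  qed
qed

text \<open>Two limits: \<open>f\<close> is the limit of its truncations to
  \<open>{0<..real k}\<close>, and each truncation is a limit of simple functions of at most twice
  its norm.\<close>

private lemma finite_pmass_in_cl:
  assumes f: "f \<in> borel_measurable half_line" "pmass half_line p f < top"
  shows "f \<in> cl"
proof (rule cl_dominated[where s = "\<lambda>k t. if t \<le> real k then f t else 0" and g = f])
  fix k
  let ?f = "\<lambda>t. if t \<le> real k then f t else 0"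
  have id: "(\<lambda>t. t) \<in> borel_measurable half_line"
    by (rule borel_measurable_half_lineI) simp
  have m: "?f \<in> borel_measurable half_line"
    using f(1) id by measurable
  obtain s where "\<forall>i. simple_function half_line (s i)"
      "\<forall>t\<in>space half_line. (\<lambda>i. s i t) \<longlonglongrightarrow> ?f t"
      "\<forall>i. \<forall>t\<in>space half_line. dist (s i t) 0 \<le> 2 * dist (?f t) 0"
    using borel_measurable_implies_sequence_metric[OF m, of 0] by blast
  then have s: "\<And>i. simple_function half_line (s i)"
      "\<And>t. 0 < t \<Longrightarrow> (\<lambda>i. s i t) \<longlonglongrightarrow> ?f t" "\<And>i t. 0 < t \<Longrightarrow> norm (s i t) \<le> 2 * norm (?f t)"
    by auto
  show "?f \<in> cl"
  proof (rule cl_dominated[where s = s and g = "\<lambda>t. 3 * f t"])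
    \<comment> \<open>The bound by \<open>2 * norm (?f t)\<close> forces \<open>s i\<close> to
      vanish wherever the truncation does, as \<open>simple_in_cl\<close> requires.\<close>
    have "s i t = 0" if "0 < t" "real k < t" for i t
      using s(3)[OF that(1), of i] that(2) by simp
    then show "s i \<in> cl" for i
      by (rule simple_in_cl[OF s(1)])
    show "(\<lambda>t. 3 * f t) \<in> borel_measurable half_line" using f(1) by measurable
    show "pmass half_line p (\<lambda>t. 3 * f t) < top"
      using f by (simp add: pmass_cmult ennreal_mult_less_top)
    fix i t assume "t \<in> space half_line"
    then have "0 < t" by simp
    then show "(\<lambda>i. s i t) \<longlonglongrightarrow> ?f t" by (rule s(2))
    have "norm (s i t - ?f t) \<le> norm (s i t) + norm (?f t)" by (rule norm_triangle_ineq4)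
    also have "\<dots> \<le> 3 * norm (?f t)" using s(3)[OF \<open>0 < t\<close>, of i] by simp
    also have "\<dots> \<le> norm (3 * f t)" by (simp add: norm_mult)
    finally show "norm (s i t - ?f t) \<le> norm (3 * f t)" .
  qed (fact m)
next
  fix t
  obtain k where "t \<le> real k" using real_arch_simple by blast
  then have "\<forall>\<^sub>F k in sequentially. (if t \<le> real k then f t else 0) = f t"
    by (intro eventually_sequentiallyI[of k]) auto
  then show "(\<lambda>k. if t \<le> real k then f t else 0) \<longlonglongrightarrow> f t"
    by (rule tendsto_eventually)
qed (use f in auto)

lemma finite_pmass_step_fun_closure:
  "f \<in> borel_measurable half_line \<Longrightarrow> pmass half_line p f < top \<Longrightarrow>
    f \<in> pclosure half_line p (step_fun ` lists (D \<times> \<rat> \<times> \<rat>))"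
  using finite_pmass_in_cl unfolding steps_def .

end

section \<open>Countable dense subsets\<close>

lemma Lp_half_line_separable:
  fixes p :: real
  assumes p: "0 < p"
  obtains Q :: "(real \<Rightarrow> 'k::{real_normed_field,second_countable_topology}) set"
    where "countable Q" "Q \<subseteq> {f \<in> borel_measurable half_line. pmass half_line p f < top}"
      "{f \<in> borel_measurable half_line. pmass half_line p f < top} \<subseteq> pclosure half_line p Q"
proof -
  obtain D :: "'k set" where D: "countable D" "\<And>X. open X \<Longrightarrow> X \<noteq> {} \<Longrightarrow> \<exists>d\<in>D. d \<in> X"
    by (erule countable_dense_setE)
  let ?Q = "step_fun ` lists (D \<times> \<rat> \<times> \<rat>)"
  show ?thesis
  proof (rule that)
    show "countable ?Q"
      using D(1) by (intro countable_image countable_lists countable_SIGMA countable_rat)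
    show "?Q \<subseteq> {f \<in> borel_measurable half_line. pmass half_line p f < top}"
      using p by (auto simp: step_fun_measurable intro: pmass_step_fun_finite)
    show "{f \<in> borel_measurable half_line. pmass half_line p f < top} \<subseteq> pclosure half_line p ?Q"
      using finite_pmass_step_fun_closure[OF D(2) p] by blast
  qed
qed

text \<open>A subset of a separable metric space is separable: each \<open>q\<close> of a countable
  dense set is replaced by elements of \<open>Y\<close> whose distance to \<open>q\<close> tends to
  0. This yields the dense sequence of nilpotent functions behind the hypercyclic vector.\<close>

lemma countable_dense_subset:
  fixes p :: real
  assumes p: "0 < p"
    and Y: "Y \<subseteq> {f \<in> borel_measurable half_line. pmass half_line p f < top}"
    and dense: "{f \<in> borel_measurable half_line. pmass half_line p f < top} \<subseteq> pclosure half_line p Y"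
  shows "\<exists>y :: nat \<Rightarrow> real \<Rightarrow> 'k::{real_normed_field,second_countable_topology}. range y \<subseteq> Y \<and>
      {f \<in> borel_measurable half_line. pmass half_line p f < top} \<subseteq> pclosure half_line p (range y)"
proof -
  obtain Q :: "(real \<Rightarrow> 'k) set" where Q: "countable Q"
      "Q \<subseteq> {f \<in> borel_measurable half_line. pmass half_line p f < top}"
      "{f \<in> borel_measurable half_line. pmass half_line p f < top} \<subseteq> pclosure half_line p Q"
    using Lp_half_line_separable[OF p] by blast
  \<comment> \<open>The implication permits a choice function on all \<open>q\<close>; outside
    \<open>Q\<close> any element of \<open>Y\<close> will do.\<close>
  have "\<exists>y\<in>Y. q \<in> Q \<longrightarrow> pmass half_line p (\<lambda>t. q t - y t) < ennreal (inverse (Suc n))" for q n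
  proof (cases "q \<in> Q")
    case True
    then have "q \<in> pclosure half_line p Y"
      using Q(2) dense by blast
    moreover have "0 < inverse (real (Suc n))" by simp
    ultimately show ?thesis unfolding pclosure_def by blast
  next
    case False
    have "(\<lambda>t. 0) \<in> pclosure half_line p Y" by (rule subsetD[OF dense]) auto
    then have "Y \<noteq> {}" by (force simp: pclosure_def dest: spec[of _ 1])
    then show ?thesis using False by auto
  qed
  then obtain h where h: "\<And>q n. h q n \<in> Y"
      "\<And>q n. q \<in> Q \<Longrightarrow> pmass half_line p (\<lambda>t. q t - h q n t) < ennreal (inverse (Suc n))"
    by metis
  \<comment> \<open>Every pair of an index of \<open>Q\<close> and a precision occurs in this
    enumeration.\<close>
  define y where "y n = (case prod_decode n of (i, j) \<Rightarrow> h (from_nat_into Q i) j)" for n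
  have ydef: "y (prod_encode (i, j)) = h (from_nat_into Q i) j" for i j
    by (simp add: y_def)
  have "f \<in> pclosure half_line p (range y)"
    if f: "f \<in> borel_measurable half_line" "pmass half_line p f < top" for f
    unfolding pclosure_def
  proof (intro CollectI conjI f(1) allI impI)
    fix e :: real assume "0 < e"
    then have d: "0 < e / (4 * 2 powr p)" by simp
    have "f \<in> pclosure half_line p Q" using Q(3) f by auto
    then obtain q where q: "q \<in> Q" "pmass half_line p (\<lambda>t. f t - q t) < ennreal (e / (4 * 2 powr p))"
      unfolding pclosure_def using d by blast
    obtain i where i: "from_nat_into Q i = q"
      using from_nat_into_surj[OF Q(1) q(1)] by blast
    obtain j where j: "inverse (real (Suc j)) < e / (4 * 2 powr p)"
      using reals_Archimedean[OF d] by blast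
    have m: "q \<in> borel_measurable half_line" "h q j \<in> borel_measurable half_line"
      using Q(2) q(1) Y h(1) by auto
    have "pmass half_line p (\<lambda>t. q t - h q j t) < ennreal (e / (4 * 2 powr p))"
      using h(2)[OF q(1), of j] by (rule less_trans) (use j d in \<open>simp add: ennreal_lessI\<close>)
    then have "ennreal (2 powr p) * (pmass half_line p (\<lambda>t. f t - q t) + pmass half_line p (\<lambda>t. q t - h q j t)) < ennreal e"
      using q(2) \<open>0 < e\<close> by (intro half_sum_less) auto
    moreover have "pmass half_line p (\<lambda>t. (f t - q t) + (q t - h q j t))
        \<le> ennreal (2 powr p) * (pmass half_line p (\<lambda>t. f t - q t) + pmass half_line p (\<lambda>t. q t - h q j t))"
      using f(1) m p by (intro pmass_add) auto
    ultimately have "pmass half_line p (\<lambda>t. f t - h q j t) < ennreal e"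
      by simp
    then show "\<exists>q\<in>range y. pmass half_line p (\<lambda>t. f t - q t) < ennreal e"
      using ydef[of i j] i by (intro bexI[where x = "h q j"]) (auto intro: range_eqI[of _ _ "prod_encode (i, j)"])
  qed
  moreover have "range y \<subseteq> Y"
    using h(1) by (auto simp: y_def split: prod.split)
  ultimately show ?thesis by blast
qed

section \<open>Translations and the weighted shift on functions\<close>

lemma subset_pclosure:
  assumes "Q \<subseteq> borel_measurable M"
  shows "Q \<subseteq> pclosure M p Q"
proof
  fix q assume q: "q \<in> Q"
  have "pmass M p (\<lambda>t. q t - q t) < ennreal e" if "0 < e" for e
    using that by simp
  then show "q \<in> pclosure M p Q"
    unfolding pclosure_def using q assms by blast
qed

section \<open>Translations of the half-line\<close>

lemma half_line_translate_left:
  assumes "0 \<le> c" "f \<in> borel_measurable half_line"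
  shows "(\<lambda>t. f (t + c)) \<in> borel_measurable half_line"
  using measurable_compose[OF translate_measurable[OF assms(1)] assms(2)] .

text \<open>Extension by zero leads to the whole line, where Lebesgue measure is translation
  invariant.\<close>

lemma half_line_extend:
  fixes f :: "real \<Rightarrow> 'b::real_normed_vector"
  assumes "f \<in> borel_measurable half_line"
  shows "(\<lambda>t. if 0 < t then f t else 0) \<in> borel_measurable lebesgue"
proof -
  have "(\<lambda>t. indicator {0<..} t *\<^sub>R f t) \<in> borel_measurable lebesgue"
    using assms by (subst (asm) borel_measurable_restrict_space_iff) auto
  also have "(\<lambda>t. indicator {0<..} t *\<^sub>R f t) = (\<lambda>t. if 0 < t then f t else 0)"
    by (auto simp: indicator_def)
  finally show ?thesis .
qed

lemma half_line_translate_right: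
  fixes f :: "real \<Rightarrow> 'b::real_normed_vector"
  assumes "0 \<le> c" "f \<in> borel_measurable half_line"
  shows "(\<lambda>t. if c < t then f (t - c) else 0) \<in> borel_measurable half_line"
proof (rule measurable_restrict_space1)
  have "(\<lambda>t. t - c) \<in> lebesgue \<rightarrow>\<^sub>M lebesgue"
    using lebesgue_affine_measurable[of "\<lambda>_. 1" "- c"] by simp
  from measurable_compose[OF this half_line_extend[OF assms(2)]]
  show "(\<lambda>t. if c < t then f (t - c) else 0) \<in> borel_measurable lebesgue" by simp
qed

lemma pmass_half_line_eq:
  assumes "0 < p"
  shows "pmass half_line p f = (\<integral>\<^sup>+t. ennreal (norm (if 0 < t then f t else 0) powr p) \<partial>lebesgue)"
  unfolding pmass_def using assms
  by (subst nn_integral_restrict_space) (auto intro!: nn_integral_cong simp: indicator_def)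

text \<open>Isometric because it is a translation, on the whole line, of the extension by
  zero.\<close>

lemma pmass_translate_right:
  assumes p: "0 < p" and c: "0 \<le> c" and f: "f \<in> borel_measurable half_line"
  shows "pmass half_line p (\<lambda>t. if c < t then f (t - c) else 0) = pmass half_line p f"
proof -
  have [measurable]: "(\<lambda>t. if 0 < t then f t else 0) \<in> borel_measurable lebesgue"
    by (rule half_line_extend[OF f])
  have "pmass half_line p f = (\<integral>\<^sup>+t. ennreal (norm (if 0 < - c + 1 * t then f (- c + 1 * t) else 0) powr p) \<partial>lebesgue)"
    unfolding pmass_half_line_eq[OF p]
    by (subst nn_integral_real_affine_lebesgue[where c = 1 and t = "- c"]) auto
  also have "\<dots> = pmass half_line p (\<lambda>t. if c < t then f (t - c) else 0)"
    unfolding pmass_half_line_eq[OF p] using c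
    by (intro nn_integral_cong) auto
  finally show ?thesis by simp
qed

text \<open>Moving the translate back to the right recovers \<open>f\<close> with
  \<open>{0<..c}\<close> erased, so only the mass on that interval is lost.\<close>

lemma pmass_translate_left:
  assumes p: "0 < p" and c: "0 \<le> c" and f: "f \<in> borel_measurable half_line"
  shows "pmass half_line p (\<lambda>t. f (t + c)) \<le> pmass half_line p f"
proof -
  have "pmass half_line p (\<lambda>t. f (t + c)) = pmass half_line p (\<lambda>t. if c < t then f (t - c + c) else 0)"
    using pmass_translate_right[OF p c half_line_translate_left[OF c f]] by simp
  also have "\<dots> \<le> pmass half_line p f"
    using p by (intro pmass_mono) auto
  finally show ?thesis .
qed

section \<open>Powers of the shift and of its right inverse, for both scalar fields at once\<close>

locale weighted_shift =
  fixes p a b :: real and w :: "real \<Rightarrow> 'k::{real_normed_field,second_countable_topology}"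
  assumes p: "1 \<le> p" and a: "0 < a" and w [measurable]: "w \<in> borel_measurable half_line"
    and b: "1 < b" and w_ge: "\<And>t. 0 < t \<Longrightarrow> b \<le> norm (w t)"
begin

abbreviation "mass \<equiv> pmass half_line p"

definition wt :: "nat \<Rightarrow> real \<Rightarrow> 'k" where
  "wt n t = (\<Prod>i<n. w (t + real i * a))"

text \<open>The power \<open>T^n\<close> on representatives, written with the weight product instead
  of by iteration.\<close>

definition bwd :: "nat \<Rightarrow> (real \<Rightarrow> 'k) \<Rightarrow> real \<Rightarrow> 'k" where
  "bwd n f t = wt n t * f (t + real n * a)"

text \<open>The power \<open>S^n\<close> of the right inverse. The weight is taken at the point
  before the translation, so that it cancels in \<open>bwd n (fwd n f)\<close>.\<close>

definition fwd :: "nat \<Rightarrow> (real \<Rightarrow> 'k) \<Rightarrow> real \<Rightarrow> 'k" where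
  "fwd n f t = (if real n * a < t then f (t - real n * a) / wt n (t - real n * a) else 0)"

lemma p_pos: "0 < p" "0 \<le> p" using p by auto

lemma wt_0 [simp]: "wt 0 t = 1" by (simp add: wt_def)

lemma bwd_0 [simp]: "bwd 0 f = f" by (simp add: bwd_def fun_eq_iff)

lemma fwd_0: "0 < t \<Longrightarrow> fwd 0 f t = f t" by (simp add: fwd_def)

lemma wt_Suc: "wt (Suc n) t = wt n t * w (t + real n * a)"
  by (simp add: wt_def)

text \<open>The cocycle identity behind the composition rules for \<open>bwd\<close> and
  \<open>fwd\<close>.\<close>

lemma wt_add: "wt (m + n) t = wt m t * wt n (t + real m * a)"
proof (induction n)
  case (Suc n)
  have "t + real (m + n) * a = t + real m * a + real n * a" by (simp add: algebra_simps)
  with Suc show ?case by (simp only: add_Suc_right wt_Suc mult.assoc)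
qed simp

lemma norm_wt_ge: "0 < t \<Longrightarrow> b ^ n \<le> norm (wt n t)"
proof (induction n)
  case (Suc n)
  have "b ^ n * b \<le> norm (wt n t) * norm (w (t + real n * a))"
    using Suc a b by (intro mult_mono w_ge add_pos_nonneg) auto
  then show ?case by (simp add: wt_Suc norm_mult mult.commute)
qed simp

lemma wt_nonzero: "0 < t \<Longrightarrow> wt n t \<noteq> 0"
  using norm_wt_ge[of t n] zero_less_power[of b n] b
  by (metis less_le_trans not_less norm_zero zero_less_one less_trans)

lemma wt_measurable [measurable]: "wt n \<in> borel_measurable half_line"
  unfolding wt_def[abs_def]
  by (intro borel_measurable_prod half_line_translate_left w) (use a in auto)

lemma bwd_measurable [measurable]:
  "f \<in> borel_measurable half_line \<Longrightarrow> bwd n f \<in> borel_measurable half_line"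
  unfolding bwd_def[abs_def]
  by (intro borel_measurable_times half_line_translate_left wt_measurable) (use a in auto)

lemma div_wt_measurable:
  "f \<in> borel_measurable half_line \<Longrightarrow> (\<lambda>t. f t / wt n t) \<in> borel_measurable half_line"
  unfolding divide_inverse
  by (intro borel_measurable_times borel_measurable_inverse wt_measurable)

lemma fwd_measurable [measurable]:
  "f \<in> borel_measurable half_line \<Longrightarrow> fwd n f \<in> borel_measurable half_line"
  unfolding fwd_def[abs_def]
  using half_line_translate_right[OF _ div_wt_measurable[of f n], of "real n * a"] a by simp

lemma mass_fwd:
  assumes "f \<in> borel_measurable half_line"
  shows "mass (fwd n f) = mass (\<lambda>t. f t / wt n t)"
  unfolding fwd_def[abs_def]
  using pmass_translate_right[OF p_pos(1) _ div_wt_measurable[OF assms], of "real n * a"] a by simp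

text \<open>Weights of length \<open>n\<close> have norm at least \<open>b ^ n\<close>. Since
  \<open>b > 1\<close>, any smaller exponent \<open>k\<close> may be used, which spares exact
  exponents later.\<close>

lemma mass_fwd_le:
  assumes f: "f \<in> borel_measurable half_line" and "k \<le> n"
  shows "mass (fwd n f) \<le> ennreal (inverse (b ^ k) powr p) * mass f"
  unfolding mass_fwd[OF f]
proof (rule pmass_le_cmult[OF f p_pos(2)])
  fix t assume "t \<in> space half_line"
  then have t: "0 < t" by simp
  have "b ^ k \<le> b ^ n" using assms(2) b by (intro power_increasing) auto
  also have "\<dots> \<le> norm (wt n t)" by (rule norm_wt_ge[OF t])
  finally have "inverse (norm (wt n t)) \<le> inverse (b ^ k)"
    using b by (intro le_imp_inverse_le) auto
  then have "norm (f t) * inverse (norm (wt n t)) \<le> norm (f t) * inverse (b ^ k)"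
    by (intro mult_left_mono) auto
  then show "norm (f t / wt n t) \<le> inverse (b ^ k) * norm (f t)"
    by (simp add: norm_divide divide_inverse[of "norm _"] mult.commute)
qed (use b in simp)

text \<open>\<open>T^n S^m = S^(m - n)\<close>: the weight of length \<open>m\<close> splits by
  \<open>wt_add\<close>, and the factor that \<open>bwd n\<close> multiplies back cancels.\<close>

lemma bwd_fwd_le:
  assumes "n \<le> m" "0 < t"
  shows "bwd n (fwd m f) t = fwd (m - n) f t"
proof -
  let ?s = "t - real (m - n) * a"
  have e: "t + real n * a - real m * a = ?s" using assms(1) by (simp add: of_nat_diff algebra_simps)
  have lt: "real m * a < t + real n * a \<longleftrightarrow> real (m - n) * a < t"
    using assms(1) by (simp add: of_nat_diff algebra_simps)
  have "wt m ?s = wt (m - n) ?s * wt n t"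
    using wt_add[of "m - n" n ?s] assms(1) by simp
  then show ?thesis
    unfolding bwd_def fwd_def e lt using wt_nonzero[OF assms(2), of n] by (simp add: mult.commute)
qed

text \<open>\<open>T^n S^m = T^(n - m)\<close>: the whole weight in \<open>fwd m\<close> cancels,
  and its cut at \<open>real m * a\<close> is inactive at the point
  \<open>t + real n * a\<close>.\<close>

lemma bwd_fwd_ge:
  assumes "m \<le> n" "0 < t"
  shows "bwd n (fwd m f) t = bwd (n - m) f t"
proof -
  let ?s = "t + real (n - m) * a"
  have e: "t + real n * a - real m * a = ?s" using assms(1) by (simp add: of_nat_diff algebra_simps)
  have s: "0 < ?s" using assms(2) a by (simp add: add_pos_nonneg)
  have lt: "real m * a < t + real n * a" using s e by simp
  have "wt n t = wt (n - m) t * wt m ?s"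
    using wt_add[of "n - m" m t] assms(1) by simp
  then show ?thesis
    unfolding bwd_def fwd_def e using lt wt_nonzero[OF s, of m] by simp
qed

section \<open>Functions annihilated by a power of the shift\<close>

text \<open>Vanishing beyond \<open>real m * a\<close> makes \<open>T^m\<close> annihilate
  \<open>y\<close>; finite mass of every \<open>bwd n y\<close> puts the class of \<open>y\<close>
  into the domain of all powers.\<close>

definition nilpotents :: "(real \<Rightarrow> 'k) set" where
  "nilpotents = {y \<in> borel_measurable half_line.
     (\<exists>m. \<forall>t>real m * a. y t = 0) \<and> (\<forall>n. mass (bwd n y) < top)}"

lemma nilpotents_bwd_zero:
  assumes "\<forall>t>real m * a. y t = 0" "m \<le> n" "0 < t"
  shows "bwd n y t = 0"
proof -
  have "real m * a \<le> real n * a" using assms(2) a by (intro mult_right_mono) auto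
  then show ?thesis using assms by (simp add: bwd_def)
qed

text \<open>The function is cut down to sets on which all relevant weights are bounded; these
  exhaust the half-line, and \<open>f\<close> itself is a majorant of the errors.\<close>

lemma nilpotents_dense:
  assumes f: "f \<in> borel_measurable half_line" "mass f < top"
  shows "f \<in> pclosure half_line p nilpotents"
proof -
  have Y: "nilpotents \<subseteq> borel_measurable half_line" by (auto simp: nilpotents_def)
  \<comment> \<open>\<open>wt i (t - real i * a)\<close> is the factor with which \<open>T^i\<close>
    carries the value at \<open>t\<close> to \<open>t - real i * a\<close>; it matters only if that
    point is still positive.\<close>
  define G where "G k = {t. t \<le> real k * a \<and> (\<forall>i. norm (if real i * a < t then wt i (t - real i * a) else 0) \<le> real k)}"
    for k :: nat
  let ?s = "\<lambda>k t. if t \<in> G k then f t else 0"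
  have s_meas: "?s k \<in> borel_measurable half_line" for k
  proof -
    have [measurable]: "(\<lambda>t. if real i * a < t then wt i (t - real i * a) else 0) \<in> borel_measurable half_line" for i
      by (rule half_line_translate_right[OF _ wt_measurable]) (use a in simp)
    have [measurable]: "(\<lambda>t. t) \<in> borel_measurable half_line"
      by (rule borel_measurable_half_lineI) simp
    show ?thesis unfolding G_def mem_Collect_eq using f(1) by measurable
  qed
  show ?thesis
  proof (rule pclosure_dominated[OF Y p_pos(1), where s = ?s and g = f])
    fix k
    have "mass (bwd n (?s k)) < top" for n
    proof -
      have "mass (bwd n (?s k)) \<le> ennreal (real k powr p) * mass (\<lambda>t. f (t + real n * a))"
      proof (rule pmass_le_cmult[OF _ p_pos(2)])
        show "(\<lambda>t. f (t + real n * a)) \<in> borel_measurable half_line"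
          using a by (intro half_line_translate_left f) simp
        fix t assume "t \<in> space half_line"
        then have t: "0 < t" by simp
        show "norm (bwd n (?s k) t) \<le> real k * norm (f (t + real n * a))"
        proof (cases "t + real n * a \<in> G k")
          case True
          then have "norm (wt n t) \<le> real k" using t by (auto simp: G_def dest!: spec[of _ n])
          then show ?thesis by (auto simp: bwd_def norm_mult intro: mult_right_mono)
        qed (simp add: bwd_def)
      qed simp
      also have "\<dots> \<le> ennreal (real k powr p) * mass f"
        using a by (intro mult_left_mono pmass_translate_left p_pos f) auto
      also have "\<dots> < top" using f by (simp add: ennreal_mult_less_top)
      finally show ?thesis .
    qed
    moreover have "\<forall>t>real k * a. ?s k t = 0" by (simp add: G_def)
    ultimately have "?s k \<in> nilpotents"
      using s_meas[of k] unfolding nilpotents_def by blast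
    then show "?s k \<in> pclosure half_line p nilpotents"
      using subset_pclosure[OF Y] by blast
  next
    fix t :: real assume "t \<in> space half_line"
    let ?v = "\<lambda>i. norm (if real i * a < t then wt i (t - real i * a) else 0)"
    obtain n where n: "t / a \<le> real n" using real_arch_simple by blast
    \<comment> \<open>Only finitely many \<open>i\<close> satisfy \<open>real i * a < t\<close>, so
      a bound for the sum of their terms bounds all of them.\<close>
    obtain m where m: "(\<Sum>i<n. ?v i) \<le> real m" using real_arch_simple by blast
    have v: "?v i \<le> real m" for i
    proof (cases "i < n")
      case True
      have "?v i \<le> (\<Sum>i<n. ?v i)" using True by (intro member_le_sum) auto
      then show ?thesis using m by linarith
    next
      case False
      then have "t / a \<le> real i" using n by linarith
      then have "\<not> real i * a < t" using a by (simp add: field_simps)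
      then show ?thesis by simp
    qed
    have "\<forall>\<^sub>F k in sequentially. ?s k t = f t"
    proof (rule eventually_sequentiallyI[of "max m n"])
      fix k assume k: "max m n \<le> k"
      have "t / a \<le> real k" using n k by linarith
      then have "t \<le> real k * a" using a by (simp add: field_simps)
      moreover have "?v i \<le> real k" for i using v[of i] k by linarith
      ultimately have "t \<in> G k" unfolding G_def by blast
      then show "?s k t = f t" by simp
    qed
    then show "(\<lambda>k. ?s k t) \<longlonglongrightarrow> f t" by (rule tendsto_eventually)
  qed (use f in auto)
qed

text \<open>When \<open>j \<le> ns j\<close>, the term \<open>fwd (ns j) (ys j) t\<close> vanishes for \<open>j \<ge> t / a\<close>, so this is
  the sum over all \<open>j\<close>.\<close>

definition series :: "(nat \<Rightarrow> nat) \<Rightarrow> (nat \<Rightarrow> real \<Rightarrow> 'k) \<Rightarrow> real \<Rightarrow> 'k" where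
  "series ns ys t = (\<Sum>j<nat \<lceil>t / a\<rceil>. fwd (ns j) (ys j) t)"

section \<open>Mass of pointwise finite series of forward shifts\<close>

context
  fixes ns :: "nat \<Rightarrow> nat" and ys :: "nat \<Rightarrow> real \<Rightarrow> 'k"
  assumes ns: "\<And>j. j \<le> ns j" and ys: "\<And>j. ys j \<in> borel_measurable half_line"
begin

text \<open>The term \<open>j\<close> starts at \<open>real (ns j) * a\<close>, which is at least
  \<open>real j * a\<close>; hence all partial sums long enough to reach \<open>t\<close> agree
  there.\<close>

lemma series_eq:
  assumes "t \<le> real n * a"
  shows "series ns ys t = (\<Sum>j<n. fwd (ns j) (ys j) t)"
  unfolding series_def
proof (rule sum.mono_neutral_left)
  have "t / a \<le> real n" using assms a by (simp add: field_simps)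
  then show "{..<nat \<lceil>t / a\<rceil>} \<subseteq> {..<n}"
    by (auto simp: nat_le_iff ceiling_le_iff intro: less_le_trans)
  show "\<forall>j\<in>{..<n} - {..<nat \<lceil>t / a\<rceil>}. fwd (ns j) (ys j) t = 0"
  proof
    fix j assume "j \<in> {..<n} - {..<nat \<lceil>t / a\<rceil>}"
    then have "t / a \<le> real j" by (auto simp: nat_le_iff ceiling_le_iff not_less)
    then have "t / a \<le> real (ns j)" using ns[of j] by linarith
    then show "fwd (ns j) (ys j) t = 0" using a by (simp add: fwd_def field_simps)
  qed
qed simp

text \<open>The number of terms depends on \<open>t\<close>, so measurability is drawn from the
  partial sums, which are eventually constant at each point.\<close>

lemma series_measurable: "series ns ys \<in> borel_measurable half_line"
proof (rule borel_measurable_LIMSEQ_metric)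
  show "(\<lambda>t. \<Sum>j<n. fwd (ns j) (ys j) t) \<in> borel_measurable half_line" for n
    using ys by (intro borel_measurable_sum fwd_measurable)
  fix t
  obtain n where n: "t / a \<le> real n" using real_arch_simple by blast
  have "\<forall>\<^sub>F n in sequentially. (\<Sum>j<n. fwd (ns j) (ys j) t) = series ns ys t"
  proof (rule eventually_sequentiallyI[of n])
    fix k assume "n \<le> k"
    then have "t / a \<le> real k" using n by linarith
    then show "(\<Sum>j<k. fwd (ns j) (ys j) t) = series ns ys t"
      using a by (intro series_eq[symmetric]) (simp add: field_simps)
  qed
  then show "(\<lambda>n. \<Sum>j<n. fwd (ns j) (ys j) t) \<longlonglongrightarrow> series ns ys t"
    by (rule tendsto_eventually)
qed

lemma bwd_series_eq:
  assumes "t + real N * a \<le> real n * a"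
  shows "bwd N (series ns ys) t = (\<Sum>j<n. bwd N (fwd (ns j) (ys j)) t)"
  unfolding bwd_def series_eq[OF assms] by (simp add: sum_distrib_left)

text \<open>Beyond the first \<open>m\<close> terms, \<open>T^N\<close> only lowers the exponents of
  the right inverse. The bounds \<open>C * (1/2) ^ Suc j\<close> sum to \<open>C\<close>, so
  \<open>pmass_series\<close> controls the tail.\<close>

lemma series_tail:
  assumes N: "\<And>j. m \<le> j \<Longrightarrow> N \<le> ns j" and "0 \<le> C"
    and C: "\<And>j. ennreal ((2 ^ Suc j) powr p) * mass (fwd (ns (m + j) - N) (ys (m + j))) \<le> ennreal (C * (1/2) ^ Suc j)"
  shows "mass (\<lambda>t. bwd N (series ns ys) t - (\<Sum>j<m. bwd N (fwd (ns j) (ys j)) t)) \<le> ennreal C"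
proof -
  have "mass (\<lambda>t. bwd N (series ns ys) t - (\<Sum>j<m. bwd N (fwd (ns j) (ys j)) t))
      \<le> (\<Sum>j. ennreal ((2 ^ Suc j) powr p) * mass (fwd (ns (m + j) - N) (ys (m + j))))"
  proof (rule pmass_series[OF _ p_pos(2)])
    show "fwd (ns (m + j) - N) (ys (m + j)) \<in> borel_measurable half_line" for j
      using ys by (rule fwd_measurable)
    fix t :: real assume "t \<in> space half_line"
    then have t: "0 < t" by simp
    obtain n where n: "(t + real N * a) / a \<le> real n" using real_arch_simple by blast
    then have "(t + real N * a) / a \<le> real (m + n)" by simp
    then have "t + real N * a \<le> real (m + n) * a" using a by (simp add: field_simps)
    then have "bwd N (series ns ys) t = (\<Sum>j<m + n. bwd N (fwd (ns j) (ys j)) t)"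
      by (rule bwd_series_eq)
    also have "\<dots> = (\<Sum>j<m. bwd N (fwd (ns j) (ys j)) t) + (\<Sum>j<n. bwd N (fwd (ns (m + j)) (ys (m + j))) t)"
      by (induction n) (simp_all add: add.assoc)
    also have "(\<Sum>j<n. bwd N (fwd (ns (m + j)) (ys (m + j))) t) = (\<Sum>j<n. fwd (ns (m + j) - N) (ys (m + j)) t)"
      by (intro sum.cong bwd_fwd_le N t) auto
    finally show "\<exists>n. bwd N (series ns ys) t - (\<Sum>j<m. bwd N (fwd (ns j) (ys j)) t) =
        (\<Sum>j<n. fwd (ns (m + j) - N) (ys (m + j)) t)" by auto
  qed
  also have "\<dots> \<le> (\<Sum>j. ennreal (C * (1/2) ^ Suc j))"
    by (intro suminf_le C) auto
  also have "\<dots> = ennreal C"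
  proof (rule suminf_ennreal_eq)
    show "(\<lambda>j. C * (1/2) ^ Suc j) sums C"
      using sums_mult[OF power_half_series, of C] by simp
  qed (use \<open>0 \<le> C\<close> in simp)
  finally show ?thesis .
qed

text \<open>The tail is handled by \<open>series_tail\<close>. Each head term is either a power of
  the shift applied to \<open>ys j\<close>, of finite mass by \<open>nilpotents\<close>, or a
  contraction of \<open>ys j\<close>.\<close>

lemma mass_bwd_series_finite:
  assumes "\<And>j. m \<le> j \<Longrightarrow> N \<le> ns j" "0 \<le> C"
    and "\<And>j. ennreal ((2 ^ Suc j) powr p) * mass (fwd (ns (m + j) - N) (ys (m + j))) \<le> ennreal (C * (1/2) ^ Suc j)"
    and Y: "\<And>j. ys j \<in> nilpotents"
  shows "mass (bwd N (series ns ys)) < top"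
proof -
  let ?S = "\<lambda>t. \<Sum>j<m. bwd N (fwd (ns j) (ys j)) t"
  have S: "mass ?S < top"
  proof (rule pmass_sum_finite[OF _ p_pos(2)])
    fix j
    show "bwd N (fwd (ns j) (ys j)) \<in> borel_measurable half_line"
      by (intro bwd_measurable fwd_measurable ys)
    show "mass (bwd N (fwd (ns j) (ys j))) < top"
    proof (cases "ns j \<le> N")
      case True
      then have "mass (bwd N (fwd (ns j) (ys j))) = mass (bwd (N - ns j) (ys j))"
        by (intro pmass_cong) (simp add: bwd_fwd_ge)
      then show ?thesis using Y[of j] by (simp add: nilpotents_def)
    next
      case False
      then have "mass (bwd N (fwd (ns j) (ys j))) = mass (fwd (ns j - N) (ys j))"
        by (intro pmass_cong) (simp add: bwd_fwd_le)
      also have "\<dots> \<le> ennreal (inverse (b ^ 0) powr p) * mass (ys j)"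
        by (rule mass_fwd_le[OF ys]) simp
      also have "\<dots> < top"
        using Y[of j] by (auto simp: nilpotents_def dest!: spec[of _ 0])
      finally show ?thesis .
    qed
  qed
  have S_meas: "?S \<in> borel_measurable half_line"
    by (intro borel_measurable_sum bwd_measurable fwd_measurable ys)
  have "mass (\<lambda>t. bwd N (series ns ys) t - ?S t) \<le> ennreal C"
    by (rule series_tail) fact+
  also have "\<dots> < top" by simp
  finally have "mass (\<lambda>t. (bwd N (series ns ys) t - ?S t) + ?S t) < top"
    using S S_meas series_measurable
    by (intro pmass_add_finite p_pos borel_measurable_diff bwd_measurable)
  then show ?thesis by simp
qed

end

end

section \<open>Periodic, hypercyclic and eigenvectors\<close>

context weighted_shift
begin

section \<open>Periodic vectors near a given function\<close>

text \<open>The base \<open>2 ^ i * inverse (b ^ k)\<close> is at most 1 and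
  \<open>p \<ge> 1\<close>, so its \<open>p\<close>-th power is at most the base. The contraction
  thus absorbs the weights of \<open>pmass_series\<close>.\<close>

lemma mass_fwd_weight:
  assumes f: "f \<in> borel_measurable half_line" "mass f < top" and "k \<le> n"
    and x: "2 ^ i * inverse (b ^ k) \<le> x" "x \<le> 1"
  shows "ennreal ((2 ^ i) powr p) * mass (fwd n f) \<le> ennreal (x * enn2real (mass f))"
proof -
  have x0: "0 < 2 ^ i * inverse (b ^ k)" using b by simp
  have "ennreal ((2 ^ i) powr p) * mass (fwd n f)
      \<le> ennreal ((2 ^ i) powr p) * (ennreal (inverse (b ^ k) powr p) * mass f)"
    by (intro mult_left_mono mass_fwd_le f assms) simp
  also have "\<dots> = ennreal ((2 ^ i * inverse (b ^ k)) powr p) * ennreal (enn2real (mass f))"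
    using f(2) b by (simp add: powr_mult ennreal_mult mult.assoc)
  also have "\<dots> \<le> ennreal x * ennreal (enn2real (mass f))"
  proof (intro mult_right_mono ennreal_leI)
    have "(2 ^ i * inverse (b ^ k)) powr p \<le> (2 ^ i * inverse (b ^ k)) powr 1"
      using x x0 p by (intro powr_mono') auto
    also have "\<dots> = 2 ^ i * inverse (b ^ k)"
      using x0 by (rule powr_one[OF less_imp_le])
    finally show "(2 ^ i * inverse (b ^ k)) powr p \<le> x" using x(1) by linarith
  qed simp
  also have "\<dots> = ennreal (x * enn2real (mass f))"
    using x0 x(1) by (simp add: ennreal_mult)
  finally show ?thesis .
qed

lemma inverse_power_small:
  assumes "0 < (e::real)"
  obtains n where "\<And>k. n \<le> k \<Longrightarrow> inverse (b ^ k) \<le> e"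
proof -
  obtain n where n: "inverse e < b ^ n" using real_arch_pow[OF b] by blast
  have "inverse (b ^ k) \<le> e" if "n \<le> k" for k
  proof -
    have "inverse e \<le> b ^ k" using n power_increasing[OF that, of b] b by linarith
    then have "inverse (b ^ k) \<le> inverse (inverse e)"
      using assms by (intro le_imp_inverse_le) auto
    then show ?thesis by simp
  qed
  then show ?thesis using that by blast
qed

text \<open>In the sum of all \<open>S^(j N) y\<close>, applying \<open>T^N\<close> annihilates the
  term \<open>j = 0\<close> and moves every other one down by one place; for large \<open>N\<close>
  the terms with \<open>j > 0\<close> are small.\<close>

lemma nilpotents_series_periodic:
  assumes y: "y \<in> nilpotents" and \<delta>: "0 < \<delta>"
  obtains z N where "z \<in> borel_measurable half_line" "\<And>n. mass (bwd n z) < top"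
    "1 \<le> N" "\<And>t. 0 < t \<Longrightarrow> bwd N z t = z t" "mass (\<lambda>t. z t - y t) < ennreal \<delta>"
proof -
  obtain m where m: "\<forall>t>real m * a. y t = 0" and ym: "y \<in> borel_measurable half_line"
    and yfin: "mass y < top"
    using y by (auto simp: nilpotents_def dest: spec[of _ 0])
  define M where "M = enn2real (mass y)"
  have M: "0 \<le> M" by (simp add: M_def)
  \<comment> \<open>The minimum with 1 gives \<open>\<theta> ^ Suc j \<le> \<theta>\<close>; the
    denominator \<open>M + 1\<close> gives \<open>\<theta> * M < \<delta>\<close> even when
    \<open>M = 0\<close>.\<close>
  define \<theta> where "\<theta> = min 1 (\<delta> / (M + 1))"
  have \<theta>: "0 < \<theta>" "\<theta> \<le> 1" using \<delta> M by (auto simp: \<theta>_def)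
  have "\<theta> * M \<le> \<delta> / (M + 1) * M" using M by (intro mult_right_mono) (auto simp: \<theta>_def)
  also have "\<dots> < \<delta>" using \<delta> M by (simp add: field_simps)
  finally have \<theta>M: "\<theta> * M < \<delta>" .
  obtain n0 where n0: "\<And>k. n0 \<le> k \<Longrightarrow> inverse (b ^ k) \<le> \<theta> / 4"
    using inverse_power_small[of "\<theta> / 4"] \<theta>(1) by auto
  \<comment> \<open>\<open>n0\<close> makes \<open>inverse (b ^ N)\<close> small, \<open>m\<close>
    makes \<open>T^N\<close> annihilate \<open>y\<close>, and the summand 1 ensures
    \<open>N \<ge> 1\<close> and \<open>j \<le> ns j\<close>.\<close>
  define N where "N = n0 + m + 1"
  have bN: "inverse (b ^ N) \<le> \<theta> / 4" using n0[of N] by (simp add: N_def)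
  define ns where "ns j = j * N" for j
  have ns: "j \<le> ns j" for j by (simp add: ns_def N_def)
  let ?z = "series ns (\<lambda>_. y)"
  have N: "n \<le> ns j" if "Suc n \<le> j" for n j using ns[of j] that by linarith
  \<comment> \<open>For \<open>T^n\<close> the head has \<open>Suc n\<close> terms; all later
    exponents exceed \<open>n\<close> by at least \<open>N * Suc j\<close>. The case
    \<open>n = 0\<close> also gives the distance to \<open>y\<close>.\<close>
  have bound: "ennreal ((2 ^ Suc j) powr p) * mass (fwd (ns (Suc n + j) - n) y)
      \<le> ennreal (\<theta> * M * (1/2) ^ Suc j)" for n j
  proof -
    have "n \<le> n * N" by (simp add: N_def)
    moreover have "ns (Suc n + j) = N * Suc j + n * N" by (simp add: ns_def algebra_simps)
    ultimately have k: "N * Suc j \<le> ns (Suc n + j) - n" by linarith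
    have "2 ^ Suc j * inverse (b ^ (N * Suc j)) = (2 * inverse (b ^ N)) ^ Suc j"
      by (simp only: power_mult power_mult_distrib power_inverse)
    also have "\<dots> \<le> (\<theta> * (1/2)) ^ Suc j" using bN b by (intro power_mono) auto
    also have "\<dots> = \<theta> ^ Suc j * (1/2) ^ Suc j" by (rule power_mult_distrib)
    also have "\<dots> \<le> \<theta> * (1/2) ^ Suc j"
      using \<theta> power_decreasing[of 1 "Suc j" \<theta>] by (intro mult_right_mono) auto
    finally have x: "2 ^ Suc j * inverse (b ^ (N * Suc j)) \<le> \<theta> * (1/2) ^ Suc j" .
    have "\<theta> * (1/2) ^ Suc j \<le> 1 * 1" using \<theta> by (intro mult_mono power_le_one) auto
    then have "\<theta> * (1/2) ^ Suc j \<le> 1" by simp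
    from mass_fwd_weight[OF ym yfin k x this] show ?thesis
      by (simp only: M_def mult_ac)
  qed
  have C: "0 \<le> \<theta> * M" using \<theta> M by simp
  show ?thesis
  proof (rule that[of ?z N])
    show "?z \<in> borel_measurable half_line" using ns ym by (rule series_measurable)
    show "mass (bwd n ?z) < top" for n
      by (rule mass_bwd_series_finite[OF ns ym N C bound y])
    show "1 \<le> N" by (simp add: N_def)
    show "bwd N ?z t = ?z t" if t: "0 < t" for t
    proof -
      obtain n where "(t + real N * a) / a \<le> real n" using real_arch_simple by blast
      then have n: "t + real N * a \<le> real n * a" using a by (simp add: field_simps)
      then have n2: "t \<le> real n * a" using a mult_nonneg_nonneg[of "real N" a] by linarith
      \<comment> \<open>One term more than \<open>t\<close> itself needs: the first is annihilated
        and the others move down by one place.\<close>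
      have n1: "t + real N * a \<le> real (Suc n) * a" using n a by (simp add: algebra_simps)
      have "bwd N ?z t = (\<Sum>j<Suc n. bwd N (fwd (ns j) y) t)"
        by (rule bwd_series_eq[OF ns ym n1])
      also have "\<dots> = bwd N (fwd 0 y) t + (\<Sum>j<n. bwd N (fwd (ns (Suc j)) y) t)"
        by (simp add: sum.lessThan_Suc_shift ns_def del: sum.lessThan_Suc)
      also have "bwd N (fwd 0 y) t = bwd N y t" using t by (simp add: bwd_fwd_ge)
      also have "\<dots> = 0" using m _ t by (rule nilpotents_bwd_zero) (simp add: N_def)
      also have "(\<Sum>j<n. bwd N (fwd (ns (Suc j)) y) t) = (\<Sum>j<n. fwd (ns j) y t)"
        using t by (intro sum.cong) (simp_all add: bwd_fwd_le ns_def)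
      also have "\<dots> = ?z t" by (rule series_eq[OF ns ym n2, symmetric])
      finally show ?thesis by simp
    qed
    have "mass (\<lambda>t. bwd 0 ?z t - (\<Sum>j<Suc 0. bwd 0 (fwd (ns j) y) t)) \<le> ennreal (\<theta> * M)"
      by (rule series_tail[OF ns ym _ C bound]) simp
    also have "mass (\<lambda>t. bwd 0 ?z t - (\<Sum>j<Suc 0. bwd 0 (fwd (ns j) y) t)) = mass (\<lambda>t. ?z t - y t)"
      by (rule pmass_cong) (simp add: ns_def fwd_0)
    also have "ennreal (\<theta> * M) < ennreal \<delta>" using \<theta>M C by (simp add: ennreal_lessI \<delta>)
    finally show "mass (\<lambda>t. ?z t - y t) < ennreal \<delta>" .
  qed
qed

lemma mass_triangle_less:
  assumes "f \<in> borel_measurable half_line" "g \<in> borel_measurable half_line" "h \<in> borel_measurable half_line"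
    and "mass (\<lambda>t. f t - g t) < ennreal (e / (4 * 2 powr p))"
    and "mass (\<lambda>t. h t - g t) < ennreal (e / (4 * 2 powr p))" and "0 < e"
  shows "mass (\<lambda>t. f t - h t) < ennreal e"
proof -
  have "mass (\<lambda>t. (f t - g t) - (h t - g t))
      \<le> ennreal (2 powr p) * (mass (\<lambda>t. f t - g t) + mass (\<lambda>t. h t - g t))"
    using assms by (intro pmass_diff p_pos) auto
  also have "\<dots> < ennreal e" using assms by (intro half_sum_less) auto
  finally show ?thesis by simp
qed

lemma periodic_approx:
  assumes f: "f \<in> borel_measurable half_line" "mass f < top" and e: "0 < e"
  obtains z N where "z \<in> borel_measurable half_line" "\<And>n. mass (bwd n z) < top"
    "1 \<le> N" "\<And>t. 0 < t \<Longrightarrow> bwd N z t = z t" "mass (\<lambda>t. z t - f t) < ennreal e"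
proof -
  have d: "0 < e / (4 * 2 powr p)" using e by simp
  obtain y where y: "y \<in> nilpotents" "mass (\<lambda>t. f t - y t) < ennreal (e / (4 * 2 powr p))"
    using nilpotents_dense[OF f] d unfolding pclosure_def by blast
  obtain z N where z: "z \<in> borel_measurable half_line" "\<And>n. mass (bwd n z) < top"
    "1 \<le> N" "\<And>t. 0 < t \<Longrightarrow> bwd N z t = z t" "mass (\<lambda>t. z t - y t) < ennreal (e / (4 * 2 powr p))"
    using nilpotents_series_periodic[OF y(1) d] by blast
  have "y \<in> borel_measurable half_line" using y(1) by (simp add: nilpotents_def)
  then have "mass (\<lambda>t. z t - f t) < ennreal e"
    by (rule mass_triangle_less[OF z(1) _ f(1) z(5) y(2) e])
  then show ?thesis using that z by blast
qed

lemma nilpotentsD: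
  assumes "y \<in> nilpotents"
  shows "y \<in> borel_measurable half_line" "mass y < top"
  using assms by (auto simp: nilpotents_def dest: spec[of _ 0])

section \<open>A hypercyclic vector\<close>

text \<open>In the sum of all \<open>S^(ns k) (y k)\<close>, the power \<open>T^(ns m)\<close>
  annihilates the terms before \<open>m\<close>, turns the term \<open>m\<close> into
  \<open>y m\<close> and leaves a small tail.\<close>

lemma hypercyclic_vector:
  "\<exists>z\<in>borel_measurable half_line. (\<forall>n. mass (bwd n z) < top) \<and>
    (\<forall>f\<in>borel_measurable half_line. mass f < top \<longrightarrow>
      (\<forall>e>0. \<exists>n. mass (\<lambda>t. bwd n z t - f t) < ennreal e))"
proof -
  have "nilpotents \<subseteq> {f \<in> borel_measurable half_line. mass f < top}"
    using nilpotentsD by blast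
  then have "\<exists>y0 :: nat \<Rightarrow> real \<Rightarrow> 'k. range y0 \<subseteq> nilpotents \<and>
      {f \<in> borel_measurable half_line. mass f < top} \<subseteq> pclosure half_line p (range y0)"
    by (rule countable_dense_subset[OF p_pos(1)]) (use nilpotents_dense in blast)
  then obtain y0 :: "nat \<Rightarrow> real \<Rightarrow> 'k" where y0: "range y0 \<subseteq> nilpotents"
    "{f \<in> borel_measurable half_line. mass f < top} \<subseteq> pclosure half_line p (range y0)"
    by blast
  \<comment> \<open>Each \<open>y0 i\<close> occurs at infinitely many places: the error at place
    \<open>m\<close> is bounded by \<open>2 * (1/2) ^ m\<close>, so arbitrarily late occurrences are
    used.\<close>
  define y where "y k = y0 (fst (prod_decode k))" for k
  have y: "y k \<in> nilpotents" for k using y0(1) by (auto simp: y_def)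
  have ym: "y k \<in> borel_measurable half_line" and yfin: "mass (y k) < top" for k
    using y[of k] by (auto intro: nilpotentsD)
  define M where "M k = enn2real (mass (y k))" for k
  \<comment> \<open>The contraction allowed for the next function \<open>y (Suc k)\<close>: it
    offsets the mass of that function and stays at most 1, as \<open>mass_fwd_weight\<close>
    demands.\<close>
  define x where "x k = (1/2) ^ k / (M (Suc k) + 1)" for k
  have M: "0 \<le> M k" for k by (simp add: M_def)
  have x: "0 < x k" "x k \<le> 1" "x k * M (Suc k) \<le> (1/2) ^ k" for k
  proof -
    show "0 < x k" using M[of "Suc k"] by (simp add: x_def)
    have "x k \<le> (1/2) ^ k / 1"
      unfolding x_def using M[of "Suc k"] by (intro divide_left_mono) auto
    also have "\<dots> \<le> 1" by (simp add: power_le_one)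
    finally show "x k \<le> 1" .
    show "x k * M (Suc k) \<le> (1/2) ^ k"
    proof -
      have "M (Suc k) / (M (Suc k) + 1) \<le> 1" using M[of "Suc k"] by simp
      then have "(1/2) ^ k * (M (Suc k) / (M (Suc k) + 1)) \<le> (1/2) ^ k"
        by (intro mult_left_le) auto
      then show ?thesis by (simp add: x_def)
    qed
  qed
  \<comment> \<open>\<open>d\<close> becomes the gap between \<open>ns k\<close> and
    \<open>ns (Suc k)\<close>: long enough for the shift to annihilate \<open>y k\<close> and to
    make \<open>y (Suc k)\<close> small, with \<open>2 ^ (k + 2)\<close> in reserve for the weights
    of \<open>pmass_series\<close>.\<close>
  have "\<exists>d. 1 \<le> d \<and> (\<forall>n\<ge>d. \<forall>t>0. bwd n (y k) t = 0) \<and> 2 ^ (k + 2) * inverse (b ^ d) \<le> x k" for k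
  proof -
    obtain m where m: "\<forall>t>real m * a. y k t = 0"
      using y[of k] unfolding nilpotents_def by blast
    obtain n where n: "\<And>i. n \<le> i \<Longrightarrow> inverse (b ^ i) \<le> x k / 2 ^ (k + 2)"
      using inverse_power_small[of "x k / 2 ^ (k + 2)"] x(1)[of k] by auto
    have "bwd i (y k) t = 0" if "m + n + 1 \<le> i" "0 < t" for i t
      using m _ that(2) by (rule nilpotents_bwd_zero) (use that in simp)
    moreover have "2 ^ (k + 2) * inverse (b ^ (m + n + 1)) \<le> x k"
      using n[of "m + n + 1"] by (simp only: pos_le_divide_eq zero_less_power zero_less_numeral mult.commute)
    ultimately show ?thesis by (intro exI[of _ "m + n + 1"]) simp
  qed
  then obtain d where d: "\<And>k. 1 \<le> d k" "\<And>k n t. d k \<le> n \<Longrightarrow> 0 < t \<Longrightarrow> bwd n (y k) t = 0"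
    "\<And>k. 2 ^ (k + 2) * inverse (b ^ d k) \<le> x k"
    by metis
  define ns where "ns k = (\<Sum>j<k. d j)" for k
  have ns_Suc: "ns (Suc k) = ns k + d k" for k by (simp add: ns_def)
  have ns_mono: "ns i \<le> ns j" if "i \<le> j" for i j
    unfolding ns_def using that by (intro sum_mono2) auto
  have ns: "k \<le> ns k" for k
  proof (induction k)
    case (Suc k)
    then show ?case using d(1)[of k] by (simp add: ns_Suc)
  qed simp
  let ?z = "series ns y"
  \<comment> \<open>From any position up to \<open>ns m\<close>, the exponent
    \<open>ns (Suc m + j)\<close> is still at least the full gap \<open>d (m + j)\<close>
    away.\<close>
  have bound: "ennreal ((2 ^ Suc j) powr p) * mass (fwd (ns (Suc m + j) - N) (y (Suc m + j)))
      \<le> ennreal (2 * (1/2) ^ m * (1/2) ^ Suc j)" if N: "N \<le> ns m" for m N j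
  proof -
    let ?k = "m + j"
    have k: "d ?k \<le> ns (Suc m + j) - N" using N ns_mono[of m ?k] by (simp add: ns_Suc)
    have "2 ^ Suc j * inverse (b ^ d ?k) \<le> 2 ^ (?k + 2) * inverse (b ^ d ?k)"
      using b by (intro mult_right_mono power_increasing) auto
    also have "\<dots> \<le> x ?k" by (rule d(3))
    finally have "2 ^ Suc j * inverse (b ^ d ?k) \<le> x ?k" .
    from mass_fwd_weight[OF ym yfin k this x(2)]
    have "ennreal ((2 ^ Suc j) powr p) * mass (fwd (ns (Suc m + j) - N) (y (Suc m + j)))
        \<le> ennreal (x ?k * M (Suc ?k))" by (simp add: M_def)
    also have "\<dots> \<le> ennreal (2 * (1/2) ^ m * (1/2) ^ Suc j)"
      using x(3)[of ?k] by (intro ennreal_leI) (simp add: power_add)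
    finally show ?thesis .
  qed
  have C: "0 \<le> 2 * (1/2::real) ^ m" for m :: nat by simp
  have tailN: "N \<le> ns j" if "N \<le> ns m" "Suc m \<le> j" for N m j
    using that ns_mono[of m j] by linarith
  have approx: "mass (\<lambda>t. bwd (ns m) ?z t - y m t) \<le> ennreal (2 * (1/2) ^ m)" for m
  proof -
    have "(\<Sum>j<Suc m. bwd (ns m) (fwd (ns j) (y j)) t) = y m t" if t: "0 < t" for t
    proof -
      have "bwd (ns m) (fwd (ns j) (y j)) t = 0" if "j < m" for j
      proof -
        have "ns j + d j \<le> ns m" using ns_mono[of "Suc j" m] that by (simp add: ns_Suc)
        then show ?thesis using t d(2)[of j "ns m - ns j" t] by (simp add: bwd_fwd_ge)
      qed
      then have "(\<Sum>j<Suc m. bwd (ns m) (fwd (ns j) (y j)) t) = bwd (ns m) (fwd (ns m) (y m)) t"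
        by simp
      then show ?thesis using t by (simp add: bwd_fwd_ge)
    qed
    then have "mass (\<lambda>t. bwd (ns m) ?z t - y m t) =
        mass (\<lambda>t. bwd (ns m) ?z t - (\<Sum>j<Suc m. bwd (ns m) (fwd (ns j) (y j)) t))"
      by (intro pmass_cong) simp
    also have "\<dots> \<le> ennreal (2 * (1/2) ^ m)"
      by (rule series_tail[OF ns ym tailN C bound]) auto
    finally show ?thesis .
  qed
  have zm: "?z \<in> borel_measurable half_line" using ns ym by (rule series_measurable)
  show ?thesis
  proof (intro bexI[where x = ?z] conjI allI ballI impI zm)
    show "mass (bwd n ?z) < top" for n
      by (rule mass_bwd_series_finite[OF ns ym tailN C bound y]) (use ns in auto)
    fix f :: "real \<Rightarrow> 'k" and e :: real
    assume f: "f \<in> borel_measurable half_line" "mass f < top" and e: "0 < e"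
    then have \<delta>: "0 < e / (4 * 2 powr p)" by simp
    obtain i where i: "mass (\<lambda>t. f t - y0 i t) < ennreal (e / (4 * 2 powr p))"
      using y0(2) f \<delta> unfolding pclosure_def by blast
    have "(\<lambda>k. 2 * (1/2::real) ^ k) \<longlonglongrightarrow> 2 * 0"
      by (intro tendsto_intros LIMSEQ_power_zero) auto
    then have "\<forall>\<^sub>F k in sequentially. 2 * (1/2::real) ^ k < e / (4 * 2 powr p)"
      using \<delta> by (intro order_tendstoD(2)[of _ "2 * 0"]) auto
    then obtain k where k: "\<And>j. k \<le> j \<Longrightarrow> 2 * (1/2::real) ^ j < e / (4 * 2 powr p)"
      by (auto simp: eventually_sequentially)
    \<comment> \<open>This index is at least \<open>k\<close> and its first component is
      \<open>i\<close>, so the error is small and \<open>y m\<close> is \<open>y0 i\<close>.\<close>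
    define m where "m = prod_encode (i, k)"
    have ymi: "y m = y0 i" by (simp add: y_def m_def)
    have "mass (\<lambda>t. bwd (ns m) ?z t - y m t) \<le> ennreal (2 * (1/2) ^ m)" by (rule approx)
    also have "\<dots> < ennreal (e / (4 * 2 powr p))"
      using k[of m] \<delta> by (intro ennreal_lessI) (auto simp: m_def le_prod_encode_2)
    finally have "mass (\<lambda>t. bwd (ns m) ?z t - y m t) < ennreal (e / (4 * 2 powr p))" .
    then have "mass (\<lambda>t. bwd (ns m) ?z t - f t) < ennreal e"
      by (rule mass_triangle_less[OF bwd_measurable[OF zm] ym f(1) _ _ e]) (use i in \<open>simp add: ymi\<close>)
    then show "\<exists>n. mass (\<lambda>t. bwd n ?z t - f t) < ennreal e" by blast
  qed
qed

section \<open>Eigenvectors for arbitrary scalars\<close>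

text \<open>The shift annihilates the first term of the series and sends each later one to
  \<open>l\<close> times its predecessor. The values on \<open>{0<..a}\<close> serve to show that
  the class of \<open>z\<close> is nonzero.\<close>

lemma eigenvector:
  fixes l :: 'k
  assumes lim: "filterlim w at_infinity at_top"
  obtains z where "z \<in> borel_measurable half_line" "mass z < top"
    "\<And>t. 0 < t \<Longrightarrow> bwd 1 z t = l * z t" "\<And>t. 0 < t \<Longrightarrow> t \<le> a \<Longrightarrow> z t = 1"
proof -
  define y where "y t = (if 0 < t \<and> t \<le> a then 1 else 0 :: 'k)" for t
  define ys where "ys j t = l ^ j * y t" for j t
  have ym: "y \<in> borel_measurable half_line"
    unfolding y_def[abs_def] by (rule borel_measurable_half_lineI) measurable
  have ysm: "ys j \<in> borel_measurable half_line" for j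
    unfolding ys_def[abs_def] using ym by measurable
  have yfin: "mass y < top" unfolding y_def[abs_def] by (rule pmass_interval_finite)
  define ns :: "nat \<Rightarrow> nat" where "ns = id"
  have ns: "j \<le> ns j" for j by (simp add: ns_def)
  \<comment> \<open>The factor 4 beats the weights \<open>2 ^ Suc j\<close> of
    \<open>pmass_series\<close> and still leaves geometric decay with ratio 1/2.\<close>
  have "\<forall>\<^sub>F t in at_top. 4 * norm l \<le> norm (w t)"
    using filterlim_at_infinity_imp_norm_at_top[OF lim] unfolding filterlim_at_top by blast
  then obtain R where R: "\<And>t. R \<le> t \<Longrightarrow> 4 * norm l \<le> norm (w t)"
    by (auto simp: eventually_at_top_linorder)
  obtain i0 where i0: "R / a \<le> real i0" using real_arch_simple by blast
  \<comment> \<open>Only the first \<open>i0\<close> factors of \<open>wt j t\<close> may have norm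
    below \<open>4 * norm l\<close>; each costs a factor of at most \<open>L\<close>, in total at
    most \<open>K\<close>, uniformly in \<open>t\<close>.\<close>
  define L where "L = 4 * norm l + 1"
  have L: "1 \<le> L" "4 * norm l \<le> L" by (auto simp: L_def)
  define K where "K = L ^ i0"
  have K: "0 < K" using L by (simp add: K_def)
  have growth: "(4 * norm l) ^ j \<le> L ^ min j i0 * norm (wt j t)" if t: "0 < t" for t j
  proof (induction j)
    case (Suc j)
    have "4 * norm l * L ^ min j i0 \<le> L ^ min (Suc j) i0 * norm (w (t + real j * a))"
    proof (cases "j < i0")
      case True
      have "1 \<le> norm (w (t + real j * a))"
        using w_ge[of "t + real j * a"] b a t by (simp add: add_pos_nonneg)
      then have "4 * norm l * L ^ j * 1 \<le> L * L ^ j * norm (w (t + real j * a))"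
        using L by (intro mult_mono) auto
      then show ?thesis using True by (simp add: min_def)
    next
      case False
      then have "real i0 * a \<le> real j * a" using a by (intro mult_right_mono) auto
      moreover have "R \<le> real i0 * a" using i0 a by (simp add: field_simps)
      ultimately have "4 * norm l \<le> norm (w (t + real j * a))" using t by (intro R) linarith
      then have "4 * norm l * L ^ i0 \<le> norm (w (t + real j * a)) * L ^ i0"
        using L by (intro mult_right_mono) auto
      moreover have "min j i0 = i0" "min (Suc j) i0 = i0" using False by auto
      ultimately show ?thesis by (simp only: mult.commute)
    qed
    then have step: "4 * norm l * L ^ min j i0 * norm (wt j t)
        \<le> L ^ min (Suc j) i0 * norm (w (t + real j * a)) * norm (wt j t)"
      by (rule mult_right_mono) simp
    have "(4 * norm l) ^ Suc j \<le> 4 * norm l * (L ^ min j i0 * norm (wt j t))"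
      using mult_left_mono[OF Suc.IH, of "4 * norm l"] by simp
    then show ?case using step by (simp add: wt_Suc norm_mult mult_ac)
  qed simp
  have ratio: "norm (l ^ j / wt j t) \<le> K * (1/4) ^ j" if t: "0 < t" for t j
  proof -
    have "L ^ min j i0 \<le> K" unfolding K_def using L by (intro power_increasing) auto
    then have "(4 * norm l) ^ j \<le> K * norm (wt j t)"
      using growth[OF t, of j] mult_right_mono[of "L ^ min j i0" K "norm (wt j t)"] by simp
    moreover have "0 < norm (wt j t)" using wt_nonzero[OF t] by simp
    ultimately show ?thesis
      by (simp add: norm_divide norm_power power_mult_distrib power_divide field_simps)
  qed
  \<comment> \<open>\<open>2 * K\<close> collects the constants from \<open>2 ^ Suc j\<close> and
    \<open>ratio\<close>; the leading 2 compensates for the exponent \<open>Suc j\<close> in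
    \<open>series_tail\<close>.\<close>
  define C where "C = 2 * (2 * K) powr p * enn2real (mass y)"
  have bound: "ennreal ((2 ^ Suc j) powr p) * mass (fwd (ns (0 + j) - 0) (ys (0 + j)))
      \<le> ennreal (C * (1/2) ^ Suc j)" for j
  proof -
    have "mass (fwd j (ys j)) = mass (\<lambda>t. ys j t / wt j t)" by (rule mass_fwd[OF ysm])
    also have "\<dots> \<le> ennreal ((K * (1/4) ^ j) powr p) * mass y"
    proof (rule pmass_le_cmult[OF ym p_pos(2)])
      fix t assume "t \<in> space half_line"
      then have "norm (l ^ j / wt j t) * norm (y t) \<le> K * (1/4) ^ j * norm (y t)"
        by (intro mult_right_mono ratio) auto
      then show "norm (ys j t / wt j t) \<le> K * (1/4) ^ j * norm (y t)"
        by (simp add: ys_def norm_mult norm_divide)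
    qed (use K in simp)
    finally have "ennreal ((2 ^ Suc j) powr p) * mass (fwd j (ys j))
        \<le> ennreal ((2 ^ Suc j) powr p) * (ennreal ((K * (1/4) ^ j) powr p) * ennreal (enn2real (mass y)))"
      using yfin by (intro mult_left_mono) simp_all
    also have "\<dots> = ennreal ((2 ^ Suc j) powr p * ((K * (1/4) ^ j) powr p) * enn2real (mass y))"
      by (simp add: ennreal_mult mult.assoc)
    also have "\<dots> \<le> ennreal (C * (1/2) ^ Suc j)"
    proof (rule ennreal_leI)
      have "(2 ^ Suc j) powr p * ((K * (1/4) ^ j) powr p) = (2 ^ Suc j * (K * (1/4) ^ j)) powr p"
        using K by (simp add: powr_mult)
      also have "2 ^ Suc j * (K * (1/4) ^ j) = 2 * K * (2 * (1/4)) ^ j"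
        by (simp only: power_mult_distrib power_Suc mult_ac)
      also have "(2 * K * (2 * (1/4)) ^ j) powr p = (2 * K) powr p * ((1/2) ^ j) powr p"
        using K by (simp add: powr_mult)
      also have "\<dots> \<le> (2 * K) powr p * ((1/2) ^ j) powr 1"
        using p by (intro mult_left_mono powr_mono') (auto simp: power_le_one)
      also have "\<dots> = (2 * K) powr p * (1/2) ^ j" by simp
      finally have "(2 ^ Suc j) powr p * ((K * (1/4) ^ j) powr p) * enn2real (mass y)
          \<le> (2 * K) powr p * (1/2) ^ j * enn2real (mass y)"
        by (rule mult_right_mono) simp
      then show "(2 ^ Suc j) powr p * ((K * (1/4) ^ j) powr p) * enn2real (mass y) \<le> C * (1/2) ^ Suc j"
        by (simp add: C_def mult_ac)
    qed
    finally show ?thesis by (simp add: ns_def)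
  qed
  let ?z = "series ns ys"
  show ?thesis
  proof (rule that[of ?z])
    show "?z \<in> borel_measurable half_line" using ns ysm by (rule series_measurable)
    have "mass (\<lambda>t. bwd 0 ?z t - (\<Sum>j<0. bwd 0 (fwd (ns j) (ys j)) t)) \<le> ennreal C"
      by (rule series_tail[OF ns ysm _ _ bound]) (simp_all add: C_def)
    also have "\<dots> < top" by simp
    finally show "mass ?z < top" by simp
    fix t :: real assume t: "0 < t"
    show "bwd 1 ?z t = l * ?z t"
    proof -
      obtain n where "t / a \<le> real n" using real_arch_simple by blast
      then have n2: "t \<le> real n * a" using a by (simp add: field_simps)
      then have n1: "t + real 1 * a \<le> real (Suc n) * a" by (simp add: algebra_simps)
      have "bwd 1 ?z t = (\<Sum>j<Suc n. bwd 1 (fwd (ns j) (ys j)) t)"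
        by (rule bwd_series_eq[OF ns ysm n1])
      also have "\<dots> = bwd 1 (fwd 0 (ys 0)) t + (\<Sum>j<n. bwd 1 (fwd (Suc j) (ys (Suc j))) t)"
        by (simp add: sum.lessThan_Suc_shift ns_def del: sum.lessThan_Suc)
      also have "bwd 1 (fwd 0 (ys 0)) t = bwd 1 (ys 0) t" using t by (simp add: bwd_fwd_ge)
      \<comment> \<open>\<open>y\<close> vanishes beyond \<open>a\<close>, and
        \<open>t + a > a\<close>.\<close>
      also have "\<dots> = 0" using t by (simp add: bwd_def ys_def y_def)
      also have "(\<Sum>j<n. bwd 1 (fwd (Suc j) (ys (Suc j))) t) = (\<Sum>j<n. l * fwd (ns j) (ys j) t)"
        using t by (intro sum.cong) (simp_all add: bwd_fwd_le fwd_def ys_def ns_def)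
      also have "\<dots> = l * ?z t"
        unfolding series_eq[OF ns ysm n2] by (rule sum_distrib_left[symmetric])
      finally show ?thesis by (simp only: add_0_left)
    qed
    assume "t \<le> a"
    then have "t \<le> real 1 * a" by simp
    from series_eq[where ns = ns and ys = ys, OF ns ysm this]
    have "?z t = fwd 0 (ys 0) t" by (simp add: ns_def)
    then show "?z t = 1" using t \<open>t \<le> a\<close> by (simp add: fwd_0 ys_def y_def)
  qed
qed

end

section \<open>The weighted shift on $L_p(0,\infty)$\<close>

lemma L0_cases:
  obtains f where "f \<in> borel_measurable half_line" "x = abs_L0 f"
proof
  show "x = abs_L0 (rep_L0 x)"
    by (rule Quotient3_abs_rep[OF Quotient3_L0, symmetric])
  show "rep_L0 x \<in> borel_measurable half_line"
    using Quotient3_rep_reflp[OF Quotient3_L0, of x] by (simp add: ae_eq_def)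
qed

lemma Lp_mass_abs: "f \<in> borel_measurable half_line \<Longrightarrow> Lp_mass p (abs_L0 f) = pmass half_line p f"
  by (simp add: Lp_mass.abs_eq ae_eq_def pmass_def)

lemma abs_L0_mem_Lp: "f \<in> borel_measurable half_line \<Longrightarrow> abs_L0 f \<in> Lp p \<longleftrightarrow> pmass half_line p f < top"
  by (simp add: Lp_def Lp_mass_abs)

lemma abs_L0_diff:
  "f \<in> borel_measurable half_line \<Longrightarrow> g \<in> borel_measurable half_line \<Longrightarrow>
    abs_L0 f - abs_L0 g = abs_L0 (\<lambda>t. f t - g t)"
  by (simp add: minus_L0.abs_eq ae_eq_def)

lemma abs_L0_scale:
  "f \<in> borel_measurable half_line \<Longrightarrow> scale_L0 c (abs_L0 f) = abs_L0 (\<lambda>t. c * f t)"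
  by (simp add: scale_L0.abs_eq ae_eq_def)

lemma abs_L0_eqI:
  assumes "f \<in> borel_measurable half_line" "g \<in> borel_measurable half_line" "\<And>t. 0 < t \<Longrightarrow> f t = g t"
  shows "abs_L0 f = abs_L0 g"
  using assms by (intro Quotient3_rel_abs[OF Quotient3_L0]) (auto simp: ae_eq_def)

lemma Lp_norm_diff_less:
  assumes "f \<in> borel_measurable half_line" "g \<in> borel_measurable half_line" "0 < p" "0 < e"
    and less: "pmass half_line p (\<lambda>t. f t - g t) < ennreal (e powr p)"
  shows "Lp_norm p (abs_L0 f - abs_L0 g) < e"
proof -
  have eq: "Lp_norm p (abs_L0 f - abs_L0 g) = enn2real (pmass half_line p (\<lambda>t. f t - g t)) powr (1 / p)"
    using assms(1,2) by (simp add: Lp_norm_def abs_L0_diff Lp_mass_abs)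
  have "enn2real (pmass half_line p (\<lambda>t. f t - g t)) < e powr p"
    using less assms(4) by (cases "pmass half_line p (\<lambda>t. f t - g t)") (auto simp: ennreal_less_iff)
  then have "enn2real (pmass half_line p (\<lambda>t. f t - g t)) powr (1 / p) < (e powr p) powr (1 / p)"
    using assms(3) by (intro powr_less_mono2) auto
  also have "\<dots> = e" using assms(3,4) by (simp add: powr_powr)
  finally show ?thesis by (simp add: eq)
qed

text \<open>Density of classes reduces to approximation of representatives: precision
  \<open>e powr p\<close> for the mass corresponds to \<open>e\<close> for the norm.\<close>

lemma norm_dense_LpI:
  fixes S :: "'k::{real_normed_field,second_countable_topology} L0 set"
  assumes p: "0 < p" and S: "S \<subseteq> Lp p"
    and approx: "\<And>(f :: real \<Rightarrow> 'k) e. f \<in> borel_measurable half_line \<Longrightarrow> pmass half_line p f < top \<Longrightarrow> 0 < e \<Longrightarrow>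
      \<exists>g\<in>borel_measurable half_line. abs_L0 g \<in> S \<and> pmass half_line p (\<lambda>t. g t - f t) < ennreal e"
  shows "norm_dense (Lp p) (Lp_norm p) S"
  unfolding norm_dense_def
proof (intro conjI S ballI allI impI)
  fix y :: "'k L0" and e :: real assume y: "y \<in> Lp p" and e: "0 < e"
  obtain f where f: "f \<in> borel_measurable half_line" "y = abs_L0 f" by (rule L0_cases)
  have "pmass half_line p f < top" using y f abs_L0_mem_Lp by blast
  then obtain g where g: "g \<in> borel_measurable half_line" "abs_L0 g \<in> S"
      "pmass half_line p (\<lambda>t. g t - f t) < ennreal (e powr p)"
    using approx[OF f(1), of "e powr p"] e by auto
  then show "\<exists>z\<in>S. Lp_norm p (z - y) < e"
    using Lp_norm_diff_less[OF g(1) f(1) p e g(3)] f(2) by blast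
qed

text \<open>With the maximal domain, membership in the domain of every power amounts to the iterates
  staying in \<open>X\<close>.\<close>

lemma dom_infI:
  assumes "\<And>n. (T ^^ n) x \<in> X"
  shows "x \<in> dom_inf X {x \<in> X. T x \<in> X} T"
proof -
  have "x \<in> dom_pow X {x \<in> X. T x \<in> X} T n" for n
    using assms
  proof (induction n arbitrary: x)
    case 0
    show ?case using 0[of 0] by simp
  next
    case (Suc n)
    have "T x \<in> dom_pow X {x \<in> X. T x \<in> X} T n"
    proof (rule Suc.IH)
      fix m show "(T ^^ m) (T x) \<in> X" using Suc.prems[of "Suc m"] by (simp add: funpow_swap1)
    qed
    then show ?case using Suc.prems[of 0] Suc.prems[of 1] by simp
  qed
  then show ?thesis by (simp add: dom_inf_def)
qed

text \<open>Supplies functions of known positive mass, against which the hypercyclic vector and the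
  eigenvectors are shown to be nonzero.\<close>

lemma pmass_unit_interval:
  assumes "0 \<le> r"
  shows "pmass half_line p (\<lambda>t. if 0 < t \<and> t \<le> r then 1 else 0 :: 'k::{real_normed_field,second_countable_topology}) = ennreal r"
proof -
  have "pmass half_line p (\<lambda>t. if 0 < t \<and> t \<le> r then 1 else 0 :: 'k) = (\<integral>\<^sup>+t. indicator {0<..r} t \<partial>lebesgue)"
    unfolding pmass_def
    by (subst nn_integral_restrict_space) (simp, intro nn_integral_cong, simp add: indicator_def)
  also have "\<dots> = ennreal r" using assms by simp
  finally show ?thesis .
qed

section \<open>Chaos and eigenvalues of the operator\<close>

context weighted_shift
begin

abbreviation "T \<equiv> wshift w a"

lemma wshift_dom_eq: "wshift_dom p w a = {x \<in> Lp p. T x \<in> Lp p}"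
  by (auto simp: wshift_dom_def Lp_def)

lemma funpow_abs: "f \<in> borel_measurable half_line \<Longrightarrow> (T ^^ n) (abs_L0 f) = abs_L0 (bwd n f)"
  using wshift_pow_abs[OF _ w, of a f n] a by (simp add: bwd_def[abs_def] wt_def)

lemma abs_mem_dom_inf:
  assumes "f \<in> borel_measurable half_line" "\<And>n. mass (bwd n f) < top"
  shows "abs_L0 f \<in> dom_inf (Lp p) (wshift_dom p w a) T"
  unfolding wshift_dom_eq
  using assms by (intro dom_infI) (simp add: funpow_abs abs_L0_mem_Lp)

lemma dom_inf_subset: "dom_inf (Lp p) (wshift_dom p w a) T \<subseteq> Lp p"
proof
  fix x assume "x \<in> dom_inf (Lp p) (wshift_dom p w a) T"
  then have "x \<in> dom_pow (Lp p) (wshift_dom p w a) T 0" unfolding dom_inf_def by blast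
  then show "x \<in> Lp p" by simp
qed

lemma norm_dense_periodic: "norm_dense (Lp p) (Lp_norm p) (periodic_points (Lp p) (wshift_dom p w a) T)"
proof (rule norm_dense_LpI[OF p_pos(1)])
  show "periodic_points (Lp p) (wshift_dom p w a) T \<subseteq> Lp p"
    using dom_inf_subset by (auto simp: periodic_points_def)
  fix f :: "real \<Rightarrow> 'k" and e :: real
  assume "f \<in> borel_measurable half_line" "mass f < top" "0 < e"
  from periodic_approx[OF this] obtain z N where z: "z \<in> borel_measurable half_line" "\<And>n. mass (bwd n z) < top"
    "1 \<le> N" "\<And>t. 0 < t \<Longrightarrow> bwd N z t = z t" "mass (\<lambda>t. z t - f t) < ennreal e"
    by blast
  have "(T ^^ N) (abs_L0 z) = abs_L0 z"
    unfolding funpow_abs[OF z(1)] by (rule abs_L0_eqI[OF bwd_measurable[OF z(1)] z(1) z(4)])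
  then have "abs_L0 z \<in> periodic_points (Lp p) (wshift_dom p w a) T"
    using abs_mem_dom_inf[OF z(1,2)] z(3) unfolding periodic_points_def by blast
  then show "\<exists>g\<in>borel_measurable half_line. abs_L0 g \<in> periodic_points (Lp p) (wshift_dom p w a) T \<and>
      mass (\<lambda>t. g t - f t) < ennreal e"
    using z(1,5) by blast
qed

lemma funpow_zero: "(T ^^ n) 0 = 0"
proof -
  have "abs_L0 (bwd n (\<lambda>t. 0)) = (0 :: 'k L0)"
    by (simp add: bwd_def[abs_def] zero_L0_def)
  then show ?thesis using funpow_abs[of "\<lambda>t. 0" n] by (simp add: zero_L0_def)
qed

lemma hypercyclic_wshift: "hypercyclic (Lp p) (Lp_norm p) (wshift_dom p w a) T"
proof -
  obtain z where z: "z \<in> borel_measurable half_line" "\<forall>n. mass (bwd n z) < top"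
    "\<forall>f\<in>borel_measurable half_line. mass f < top \<longrightarrow>
      (\<forall>e>0. \<exists>n. mass (\<lambda>t. bwd n z t - f t) < ennreal e)"
    using hypercyclic_vector by blast
  have orbit: "{(T ^^ n) (abs_L0 z) |n. True} \<subseteq> Lp p"
    using z(1,2) by (auto simp: funpow_abs abs_L0_mem_Lp)
  have dense: "norm_dense (Lp p) (Lp_norm p) {(T ^^ n) (abs_L0 z) |n. True}"
  proof (rule norm_dense_LpI[OF p_pos(1) orbit])
    fix f :: "real \<Rightarrow> 'k" and e :: real
    assume "f \<in> borel_measurable half_line" "mass f < top" "0 < e"
    then obtain n where "mass (\<lambda>t. bwd n z t - f t) < ennreal e" using z(3) by blast
    moreover have "abs_L0 (bwd n z) \<in> {(T ^^ n) (abs_L0 z) |n. True}"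
      using funpow_abs[OF z(1), of n, symmetric] by blast
    ultimately show "\<exists>g\<in>borel_measurable half_line. abs_L0 g \<in> {(T ^^ n) (abs_L0 z) |n. True} \<and>
        mass (\<lambda>t. g t - f t) < ennreal e"
      using bwd_measurable[OF z(1), of n] by blast
  qed
  \<comment> \<open>Otherwise the orbit is \<open>{0}\<close>, while the indicator of
    \<open>{0<..1}\<close> has norm 1 and so is not within distance less than 1 of it.\<close>
  have "abs_L0 z \<noteq> 0"
  proof
    assume 0: "abs_L0 z = 0"
    let ?f = "\<lambda>t. if 0 < t \<and> t \<le> 1 then 1 else 0 :: 'k"
    have f: "?f \<in> borel_measurable half_line" by (rule borel_measurable_half_lineI) measurable
    have m: "mass ?f = 1" using pmass_unit_interval[of 1 p, where 'k = 'k] by simp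
    then have "abs_L0 ?f \<in> Lp p" using f by (simp add: abs_L0_mem_Lp)
    then have "\<exists>u\<in>{(T ^^ n) (abs_L0 z) |n. True}. Lp_norm p (u - abs_L0 ?f) < 1"
      using dense zero_less_one unfolding norm_dense_def by blast
    then obtain n where "Lp_norm p ((T ^^ n) (abs_L0 z) - abs_L0 ?f) < 1"
      by blast
    then have "Lp_norm p (0 - abs_L0 ?f) < 1" by (simp only: 0 funpow_zero)
    moreover have "0 - abs_L0 ?f = abs_L0 (\<lambda>t. 0 - ?f t)"
      using abs_L0_diff[of "\<lambda>t. 0" ?f] f by (simp add: zero_L0_def)
    moreover have "Lp_mass p (abs_L0 (\<lambda>t. 0 - ?f t)) = mass (\<lambda>t. 0 - ?f t)"
      using f by (intro Lp_mass_abs borel_measurable_diff) simp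
    moreover have "mass (\<lambda>t. 0 - ?f t) = mass ?f" by (rule pmass_cong) simp
    ultimately show False using m by (simp add: Lp_norm_def)
  qed
  then show ?thesis
    unfolding hypercyclic_def using abs_mem_dom_inf[OF z(1)] z(2) dense by blast
qed

lemma chaotic_wshift: "chaotic (Lp p) (Lp_norm p) (wshift_dom p w a) T"
  unfolding chaotic_def using hypercyclic_wshift norm_dense_periodic by blast

text \<open>The eigenvector and 0 are distinct points of the domain that are both sent to 0.\<close>

lemma wshift_eigenvalue:
  fixes l :: 'k
  assumes "filterlim w at_infinity at_top"
  shows "\<not> inj_on (\<lambda>x. T x - scale_L0 l x) (wshift_dom p w a)"
proof
  assume inj: "inj_on (\<lambda>x. T x - scale_L0 l x) (wshift_dom p w a)"
  obtain z where z: "z \<in> borel_measurable half_line" "mass z < top"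
    "\<And>t. 0 < t \<Longrightarrow> bwd 1 z t = l * z t" "\<And>t. 0 < t \<Longrightarrow> t \<le> a \<Longrightarrow> z t = 1"
    using eigenvector[OF assms] by blast
  have lz: "(\<lambda>t. l * z t) \<in> borel_measurable half_line" using z(1) by measurable
  have Tz: "T (abs_L0 z) = scale_L0 l (abs_L0 z)"
  proof -
    have "T (abs_L0 z) = abs_L0 (bwd 1 z)" using funpow_abs[OF z(1), of 1] by simp
    also have "\<dots> = abs_L0 (\<lambda>t. l * z t)"
      by (rule abs_L0_eqI[OF bwd_measurable[OF z(1)] lz z(3)])
    finally show ?thesis by (simp add: abs_L0_scale[OF z(1)])
  qed
  have "abs_L0 z \<in> wshift_dom p w a"
    unfolding wshift_dom_eq using z(1,2) lz
    by (simp add: Tz abs_L0_scale abs_L0_mem_Lp pmass_cmult ennreal_mult_less_top)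
  moreover have 0: "(0 :: 'k L0) = abs_L0 (\<lambda>t. 0)" by (simp add: zero_L0_def)
  have T0: "T 0 = 0" using funpow_zero[of 1] by simp
  have Lp0: "(0 :: 'k L0) \<in> Lp p" unfolding 0 by (simp add: abs_L0_mem_Lp)
  have "0 \<in> wshift_dom p w a" unfolding wshift_dom_eq by (simp add: T0 Lp0)
  moreover have "scale_L0 l 0 = 0" unfolding 0 by (subst abs_L0_scale) auto
  ultimately have "abs_L0 z = 0"
    using inj T0 Tz unfolding inj_on_def by auto
  then have "Lp_mass p (abs_L0 z) = Lp_mass p (abs_L0 (\<lambda>t. 0 :: 'k))" unfolding 0 by simp
  then have "mass z = 0" using z(1) by (simp add: Lp_mass_abs)
  \<comment> \<open>\<open>z\<close> equals 1 on \<open>{0<..a}\<close>, so its mass is at least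
    \<open>a\<close>, which is positive.\<close>
  moreover have "mass (\<lambda>t. if 0 < t \<and> t \<le> a then 1 else 0 :: 'k) \<le> mass z"
    using z(4) by (intro pmass_mono p_pos) auto
  ultimately show False using pmass_unit_interval[of a p, where 'k = 'k] a by simp
qed

end

theorem theorem1p2:
  fixes p a :: real
  assumes "1 \<le> p" and "a > 0"
  shows
    "(\<forall>w :: real \<Rightarrow> real.
        w \<in> borel_measurable half_line \<longrightarrow>
        \<not> bounded (w ` {0<..}) \<longrightarrow>
        filterlim w at_infinity at_top \<longrightarrow>
        (\<exists>b>1. \<forall>t>0. norm (w t) > b) \<longrightarrow>
        chaotic (Lp p) (Lp_norm p) (wshift_dom p w a) (wshift w a)) \<and>
     (\<forall>w :: real \<Rightarrow> complex.
        w \<in> borel_measurable half_line \<longrightarrow>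
        \<not> bounded (w ` {0<..}) \<longrightarrow>
        filterlim w at_infinity at_top \<longrightarrow>
        (\<exists>b>1. \<forall>t>0. norm (w t) > b) \<longrightarrow>
        chaotic (Lp p) (Lp_norm p) (wshift_dom p w a) (wshift w a) \<and>
        op_spectrum scale_L0 (Lp p) (wshift_dom p w a) (wshift w a) = UNIV \<and>
        op_point_spectrum scale_L0 (wshift_dom p w a) (wshift w a) = UNIV)"
proof (intro conjI allI impI)
  fix w :: "real \<Rightarrow> real"
  assume w: "w \<in> borel_measurable half_line" and "\<exists>b>1. \<forall>t>0. norm (w t) > b"
  then obtain b where "1 < b" "\<forall>t>0. b < norm (w t)" by blast
  then have "weighted_shift p a b w"
    using assms w by (simp add: weighted_shift_def less_imp_le)
  then show "chaotic (Lp p) (Lp_norm p) (wshift_dom p w a) (wshift w a)"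
    by (rule weighted_shift.chaotic_wshift)
next
  fix w :: "real \<Rightarrow> complex"
  assume w: "w \<in> borel_measurable half_line" and "\<exists>b>1. \<forall>t>0. norm (w t) > b"
    and lim: "filterlim w at_infinity at_top"
  then obtain b where "1 < b" "\<forall>t>0. b < norm (w t)" by blast
  then have ws: "weighted_shift p a b w"
    using assms w by (simp add: weighted_shift_def less_imp_le)
  show "chaotic (Lp p) (Lp_norm p) (wshift_dom p w a) (wshift w a)"
    by (rule weighted_shift.chaotic_wshift[OF ws])
  show "op_spectrum scale_L0 (Lp p) (wshift_dom p w a) (wshift w a) = UNIV"
    "op_point_spectrum scale_L0 (wshift_dom p w a) (wshift w a) = UNIV"
    \<comment> \<open>Failure of injectivity puts every scalar into the point spectrum; it also
      excludes bijectivity, so every scalar lies in the spectrum.\<close>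
    using weighted_shift.wshift_eigenvalue[OF ws lim]
    by (auto simp: op_spectrum_def op_point_spectrum_def dest: bij_betw_imp_inj_on)
qed

end
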